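(* For each $n$ let $\mathbf{p}^{(n)}=(p_1,\dots,p_m)$, $m=m(n)$, be a vector of probabilities such that $n\sum_{i=1}^m p_i^2=c$ for a constant $c>1$, and suppose there exists $\gamma>1/2$ such that $p=\max_i p_i=o(n^{-\gamma})$. Let $G$ be the inhomogeneous random intersection graph with parameters $n$ and $\mathbf{p}^{(n)}$. Then with high probability $G$ has a unique giant (largest) component. If $p^{-1}=o(n)$, this component has size $\Omega(p^{-1})$; otherwise it has size $\Omega(n)$. All other components have size $O(\max\{np\log n,\ \log n\})$.
   Context: Inhomogeneous random intersection graph: given $n$ vertices $V$, attributes $A=\{a_1,\dots,a_m\}$ and probabilities $\mathbf{p}=(p_i)_{i=1}^m$, let $\mathcal{I}_{v,a_i}$, $(v,a_i)\in V\times A$, be independent Bernoulli$(p_i)$ random variables. The random bipartite graph $B$ on $V\cup A$ has edge $(v,a_i)$ iff $\mathcal{I}_{v,a_i}=1$; the random intersection graph $G$ on $V$ joins two distinct vertices iff they share at least one common attribute in $B$. Results are asymptotic as $n\to\infty$ for a sequence of parameter vectors $\mathbf{p}^{(n)}$; an event holds with high probability if its probability tends to $1$ as $n\to\infty$.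
   Formalization: "Otherwise" is read as p^{-1}=Ω(n), since for sequences where p^{-1} is neither o(n) nor Ω(n) the size Ω(n) can fail along a subsequence; for every sequence a unique giant of size Ω(min{p^{-1},n}) is proved, with the same bound on the other components. *)

theory Defs
  imports "HOL-Probability.Probability" "HOL-Library.Landau_Symbols"
begin

text \<open>
  The vertices are the numbers below \<open>n\<close>, the attributes the numbers below \<open>m\<close>. The indicator
  \<open>B (v, i)\<close> says that vertex \<open>v\<close> has attribute \<open>i\<close>.
\<close>

definition bipartite_pmf :: "nat \<Rightarrow> nat \<Rightarrow> (nat \<Rightarrow> real) \<Rightarrow> (nat \<times> nat \<Rightarrow> bool) pmf" where
  "bipartite_pmf n m p = Pi_pmf ({..<n} \<times> {..<m}) False (\<lambda>(v, i). bernoulli_pmf (p i))"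

definition intersection_edges :: "nat \<Rightarrow> nat \<Rightarrow> (nat \<times> nat \<Rightarrow> bool) \<Rightarrow> (nat \<times> nat) set" where
  "intersection_edges n m B =
     {(u, v). u < n \<and> v < n \<and> u \<noteq> v \<and> (\<exists>i<m. B (u, i) \<and> B (v, i))}"

text \<open>
  \<open>E\<close> is a symmetric relation on \<open>V\<close>, so the classes of its reflexive transitive closure
  are the vertex sets of the connected components.
\<close>

definition components :: "'a set \<Rightarrow> ('a \<times> 'a) set \<Rightarrow> 'a set set" where
  "components V E = V // E\<^sup>*"

definition unique_largest_component :: "'a set \<Rightarrow> ('a \<times> 'a) set \<Rightarrow> 'a set \<Rightarrow> bool" where
  "unique_largest_component V E C \<longleftrightarrow>
     C \<in> components V E \<and> (\<forall>C' \<in> components V E. C' \<noteq> C \<longrightarrow> card C' < card C)"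

definition giant_component :: "'a set \<Rightarrow> ('a \<times> 'a) set \<Rightarrow> real \<Rightarrow> real \<Rightarrow> bool" where
  "giant_component V E s r \<longleftrightarrow>
     (\<exists>C. unique_largest_component V E C \<and> s \<le> real (card C) \<and>
          (\<forall>C' \<in> components V E. C' \<noteq> C \<longrightarrow> real (card C') \<le> r))"

definition whp_intersection_graph ::
    "(nat \<Rightarrow> nat) \<Rightarrow> (nat \<Rightarrow> nat \<Rightarrow> real) \<Rightarrow> (nat \<Rightarrow> nat set \<Rightarrow> (nat \<times> nat) set \<Rightarrow> bool) \<Rightarrow> bool" where
  "whp_intersection_graph m p Q \<longleftrightarrow>
     (\<lambda>n. measure_pmf.prob (bipartite_pmf n (m n) (p n))
            {B. Q n {..<n} (intersection_edges n (m n) B)}) \<longlonglongrightarrow> 1"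

definition max_prob :: "(nat \<Rightarrow> nat) \<Rightarrow> (nat \<Rightarrow> nat \<Rightarrow> real) \<Rightarrow> nat \<Rightarrow> real" where
  "max_prob m p n = Max (p n ` {..<m n})"

text \<open>
  The giant has at least \<open>\<delta> * s n\<close> vertices and every other component at most
  \<open>K * max {n p log n, log n}\<close>, with constants that do not depend on \<open>n\<close>.
\<close>

definition whp_giant_of_order ::
    "(nat \<Rightarrow> nat) \<Rightarrow> (nat \<Rightarrow> nat \<Rightarrow> real) \<Rightarrow> (nat \<Rightarrow> real) \<Rightarrow> bool" where
  "whp_giant_of_order m p s \<longleftrightarrow>
     (\<exists>\<delta>>0. \<exists>K>0. whp_intersection_graph m p
        (\<lambda>n V E. giant_component V E (\<delta> * s n)
           (K * max (real n * max_prob m p n * ln (real n)) (ln (real n)))))"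

end

(*
Explore the graph vertex by vertex, revealing for the current vertex its unused attributes and then
their other owners. After k steps each attribute i is still unused with probability (1 - p_i)^k,
independently, so the used attributes have total probability close to c k / n, and a vertex is
undiscovered only if it has none of them. Exponential moments show that, with 1 < b < a < c and
s = min (1 / p) n, outside an event of probability exp (- const k s / n) the used mass is at least
a k / n and at least b k vertices are discovered. With high probability this holds from every
starting vertex and for all k between k1 = K log n * n / s and k2 = d s. Then at least (b - 1) k
vertices are active, so every component either is exhausted within k1 steps or reaches
step k2. Two components that reach step k2 coincide: otherwise the second one, which is determined
by the rows of the undiscovered vertices, owns attributes of mass a k2 / n that none of the
(b - 1) k2 active vertices of the first one has. This has probability at most
exp (- (b - 1) a k2^2 / n), which is smaller than every power of 1 / n since p = o(n^-gamma) with
gamma > 1/2.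
*)

theory Submission
  imports Defs
begin

section \<open>Random subsets\<close>

text \<open>The mean of \<open>f\<close> over a random subset of \<open>S\<close> that contains each \<open>x\<close> independently with probability \<open>q x\<close>.\<close>

definition bexp :: "('a \<Rightarrow> real) \<Rightarrow> 'a set \<Rightarrow> ('a set \<Rightarrow> real) \<Rightarrow> real" where
  "bexp q S f = (\<Sum>X\<in>Pow S. (\<Prod>x\<in>X. q x) * (\<Prod>x\<in>S - X. 1 - q x) * f X)"

lemma bexp_empty [simp]: "bexp q {} f = f {}"
  by (simp add: bexp_def)

text \<open>Condition on whether \<open>x\<close> is chosen. This recursion drives the inductions
  over \<open>S\<close> below.\<close>

lemma bexp_insert:
  assumes "finite S" "x \<notin> S"
  shows "bexp q (insert x S) f = q x * bexp q S (\<lambda>X. f (insert x X)) + (1 - q x) * bexp q S f"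
proof -
  let ?g = "\<lambda>X. (\<Prod>x\<in>X. q x) * (\<Prod>y\<in>insert x S - X. 1 - q y) * f X"
  have "bexp q (insert x S) f = sum ?g (Pow S) + sum ?g (insert x ` Pow S)"
    unfolding bexp_def Pow_insert using assms by (intro sum.union_disjoint) auto
  also have "sum ?g (insert x ` Pow S) = (\<Sum>X\<in>Pow S. ?g (insert x X))"
    using assms by (subst sum.reindex) (auto simp: inj_on_def)
  also have "\<dots> = q x * bexp q S (\<lambda>X. f (insert x X))"
    unfolding bexp_def sum_distrib_left
  proof (intro sum.cong refl)
    fix X assume X: "X \<in> Pow S"
    then have "finite X" "x \<notin> X" "insert x S - insert x X = S - X"
      using assms finite_subset by auto
    then show "?g (insert x X) = q x * (prod q X * (\<Prod>x\<in>S - X. 1 - q x) * f (insert x X))"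
      by simp
  qed
  also have "sum ?g (Pow S) = (1 - q x) * bexp q S f"
    unfolding bexp_def sum_distrib_left
  proof (intro sum.cong refl)
    fix X assume X: "X \<in> Pow S"
    then have "finite (S - X)" "x \<notin> S - X" "insert x S - X = insert x (S - X)"
      using assms finite_subset by auto
    then show "?g X = (1 - q x) * (prod q X * (\<Prod>x\<in>S - X. 1 - q x) * f X)"
      by simp
  qed
  finally show ?thesis by simp
qed

lemma bexp_cong:
  assumes "\<And>x. x \<in> S \<Longrightarrow> q x = q' x" "\<And>X. X \<subseteq> S \<Longrightarrow> f X = g X"
  shows "bexp q S f = bexp q' S g"
  unfolding bexp_def using assms by (intro sum.cong refl arg_cong2[of _ _ _ _ "(*)"] prod.cong) auto

lemma bexp_cmult: "bexp q S (\<lambda>X. a * f X) = a * bexp q S f"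
  by (simp add: bexp_def sum_distrib_left mult_ac)

lemma bexp_mult_const: "bexp q S (\<lambda>X. f X * a) = bexp q S f * a"
  unfolding mult.commute[of _ a] by (rule bexp_cmult)

lemma bexp_linear: "bexp q S (\<lambda>X. a * f X + b * g X) = a * bexp q S f + b * bexp q S g"
  by (simp add: bexp_def sum_distrib_left sum.distrib algebra_simps)

lemma bexp_const:
  assumes "finite S"
  shows "bexp q S (\<lambda>_. a) = a"
  using assms by (induction S) (auto simp: bexp_insert algebra_simps)

lemma bexp_sum: "bexp q S (\<lambda>X. \<Sum>i\<in>I. f i X) = (\<Sum>i\<in>I. bexp q S (f i))"
  unfolding bexp_def sum_distrib_left by (rule sum.swap)

lemma bexp_one:
  assumes "finite S"
  shows "bexp (\<lambda>_. 1) S f = f S"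
  using assms by (induction S arbitrary: f) (auto simp: bexp_insert)

text \<open>The identities for \<open>bexp\<close> are algebraic and hold for arbitrary real
  weights; a comparison needs nonnegative ones, so here \<open>q\<close> must take values between 0
  and 1.\<close>

lemma bexp_mono:
  assumes "\<And>x. x \<in> S \<Longrightarrow> 0 \<le> q x \<and> q x \<le> 1" "\<And>X. X \<subseteq> S \<Longrightarrow> f X \<le> g X"
  shows "bexp q S f \<le> bexp q S g"
  unfolding bexp_def using assms
  by (intro sum_mono mult_left_mono mult_nonneg_nonneg prod_nonneg) auto

text \<open>Independence over disjoint index sets: expose \<open>S\<close> first, then
  \<open>T\<close>.\<close>

lemma bexp_union:
  assumes "finite S" "finite T" "S \<inter> T = {}"
  shows "bexp q (S \<union> T) f = bexp q S (\<lambda>X. bexp q T (\<lambda>Y. f (X \<union> Y)))"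
  using assms
proof (induction S arbitrary: f)
  case (insert x S)
  then show ?case by (simp add: bexp_insert)
qed simp

lemma bexp_swap:
  "bexp q S (\<lambda>X. bexp r T (\<lambda>Y. f X Y)) = bexp r T (\<lambda>Y. bexp q S (\<lambda>X. f X Y))"
proof -
  have "bexp q S (\<lambda>X. bexp r T (\<lambda>Y. f X Y)) =
    (\<Sum>X\<in>Pow S. \<Sum>Y\<in>Pow T. ((\<Prod>x\<in>X. q x) * (\<Prod>x\<in>S - X. 1 - q x)) *
        ((\<Prod>x\<in>Y. r x) * (\<Prod>x\<in>T - Y. 1 - r x) * f X Y))"
    unfolding bexp_def sum_distrib_left ..
  also have "\<dots> = (\<Sum>Y\<in>Pow T. \<Sum>X\<in>Pow S. ((\<Prod>x\<in>X. q x) * (\<Prod>x\<in>S - X. 1 - q x)) *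
        ((\<Prod>x\<in>Y. r x) * (\<Prod>x\<in>T - Y. 1 - r x) * f X Y))"
    by (rule sum.swap)
  also have "\<dots> = bexp r T (\<lambda>Y. bexp q S (\<lambda>X. f X Y))"
    unfolding bexp_def sum_distrib_left by (intro sum.cong refl) (simp add: mult_ac)
  finally show ?thesis .
qed

lemma bexp_image:
  assumes "finite S" "inj_on h S"
  shows "bexp q (h ` S) f = bexp (q \<circ> h) S (\<lambda>X. f (h ` X))"
  using assms
proof (induction S arbitrary: f)
  case (insert x S)
  then show ?case by (simp add: bexp_insert)
qed simp

lemma bexp_prod:
  assumes "finite S"
  shows "bexp q S (\<lambda>X. \<Prod>x\<in>S. if x \<in> X then g x else h x) = (\<Prod>x\<in>S. q x * g x + (1 - q x) * h x)"
  using assms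
proof (induction S)
  case (insert x S)
  have 1: "bexp q S (\<lambda>X. \<Prod>y\<in>insert x S. if y \<in> insert x X then g y else h y) =
      bexp q S (\<lambda>X. g x * (\<Prod>y\<in>S. if y \<in> X then g y else h y))"
    using insert.hyps by (intro bexp_cong refl) (auto intro!: prod.cong)
  have 2: "bexp q S (\<lambda>X. \<Prod>y\<in>insert x S. if y \<in> X then g y else h y) =
      bexp q S (\<lambda>X. h x * (\<Prod>y\<in>S. if y \<in> X then g y else h y))"
    using insert.hyps by (intro bexp_cong refl) auto
  show ?case
    unfolding bexp_insert[OF insert.hyps] 1 2 bexp_cmult insert.IH
    using insert.hyps by (simp add: algebra_simps)
qed simp

text \<open>Two-stage sampling: \<open>x\<close> ends up in the second set if it escapes the first
  and is then kept. With \<open>q = p\<close> and \<open>r i = (1 - p i) ^ k\<close> this turns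
  survival of \<open>k\<close> steps into survival of \<open>Suc k\<close> steps.\<close>

lemma bexp_thin:
  assumes "finite S"
  shows "bexp q S (\<lambda>X. bexp r (S - X) f) = bexp (\<lambda>x. (1 - q x) * r x) S f"
  using assms
proof (induction S arbitrary: f)
  case (insert x S)
  have 1: "bexp q S (\<lambda>X. bexp r (insert x S - insert x X) f) = bexp q S (\<lambda>X. bexp r (S - X) f)"
    using insert.hyps by (intro bexp_cong refl arg_cong2[of _ _ _ _ "bexp r"]) auto
  have 2: "bexp q S (\<lambda>X. bexp r (insert x S - X) f) =
      bexp q S (\<lambda>X. bexp r (S - X) (\<lambda>Y. r x * f (insert x Y) + (1 - r x) * f Y))"
  proof (intro bexp_cong refl)
    fix X assume "X \<subseteq> S"
    then have "insert x S - X = insert x (S - X)" using insert.hyps by auto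
    then show "bexp r (insert x S - X) f =
        bexp r (S - X) (\<lambda>Y. r x * f (insert x Y) + (1 - r x) * f Y)"
      using insert.hyps
      by (simp add: bexp_insert bexp_linear)
  qed
  have "bexp q (insert x S) (\<lambda>X. bexp r (insert x S - X) f) =
      q x * bexp q S (\<lambda>X. bexp r (S - X) f) +
      (1 - q x) * bexp q S (\<lambda>X. bexp r (S - X) (\<lambda>Y. r x * f (insert x Y) + (1 - r x) * f Y))"
    using insert.hyps by (simp add: bexp_insert 1 2)
  also have "\<dots> = bexp (\<lambda>x. (1 - q x) * r x) (insert x S) f"
    using insert.hyps by (simp add: insert.IH bexp_insert bexp_linear) (simp add: algebra_simps)
  finally show ?case .
qed simp

text \<open>Bridge from the product distribution to finite sums: a Boolean function is identified
  with the set of points where it is true.\<close>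

lemma prob_Pi_pmf_bernoulli:
  assumes "finite S" "\<And>x. x \<in> S \<Longrightarrow> 0 \<le> q x \<and> q x \<le> 1"
  shows "measure_pmf.prob (Pi_pmf S False (\<lambda>x. bernoulli_pmf (q x))) {B. Q {x. B x}} =
         bexp q S (\<lambda>X. of_bool (Q X))"
proof -
  let ?M = "Pi_pmf S False (\<lambda>x. bernoulli_pmf (q x))"
  let ?h = "\<lambda>X x. x \<in> X"
  have inj: "inj_on ?h (Pow S)"
    by (auto simp: inj_on_def fun_eq_iff)
  \<comment> \<open>The default value \<open>False\<close> off \<open>S\<close> confines the support
    to indicators of subsets of \<open>S\<close>, so the expectation is a finite sum.\<close>
  have sup: "set_pmf ?M \<subseteq> ?h ` Pow S"
  proof
    fix B assume "B \<in> set_pmf ?M"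
    then have "\<forall>x. x \<notin> S \<longrightarrow> B x = False"
      using set_Pi_pmf_subset[OF assms(1), of False "\<lambda>x. bernoulli_pmf (q x)"] by auto
    then show "B \<in> ?h ` Pow S"
      by (intro image_eqI[of _ _ "{x. B x}"]) auto
  qed
  have "measure_pmf.prob ?M {B. Q {x. B x}} = measure_pmf.expectation ?M (indicator {B. Q {x. B x}})"
    by simp
  also have "\<dots> = (\<Sum>B\<in>?h ` Pow S. pmf ?M B * indicator {B. Q {x. B x}} B)"
    using assms(1) sup by (subst integral_measure_pmf_real[of "?h ` Pow S"]) (auto simp: mult.commute)
  also have "\<dots> = (\<Sum>X\<in>Pow S. pmf ?M (?h X) * of_bool (Q X))"
    using inj by (subst sum.reindex) (auto simp: indicator_def)
  also have "\<dots> = bexp q S (\<lambda>X. of_bool (Q X))"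
    unfolding bexp_def
  proof (intro sum.cong refl)
    fix X assume X: "X \<in> Pow S"
    have "pmf ?M (?h X) = (\<Prod>x\<in>S. pmf (bernoulli_pmf (q x)) (x \<in> X))"
      using assms(1) X by (subst pmf_Pi) auto
    also have "\<dots> = (\<Prod>x\<in>S - X. pmf (bernoulli_pmf (q x)) (x \<in> X)) * 
       (\<Prod>x\<in>X. pmf (bernoulli_pmf (q x)) (x \<in> X))"
      using X assms(1) by (intro prod.subset_diff) auto
    also have "\<dots> = (\<Prod>x\<in>S - X. 1 - q x) * (\<Prod>x\<in>X. q x)"
      using X assms(2) by (intro arg_cong2[of _ _ _ _ "(*)"] prod.cong) auto
    finally show "pmf ?M (?h X) * of_bool (Q X) = prod q X * (\<Prod>x\<in>S - X. 1 - q x) * of_bool (Q X)"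
      by simp
  qed
  finally show ?thesis .
qed

section \<open>Exploration of the bipartite graph\<close>

text \<open>
  A state \<open>(A, U, J)\<close> consists of the active vertices, the undiscovered vertices and the unused
  attributes; the vertices in neither \<open>A\<close> nor \<open>U\<close> are processed. When no vertex is active, the
  exploration restarts from an undiscovered one.
\<close>

type_synonym exploration = "nat set \<times> nat set \<times> nat set"

definition nbrs :: "nat set \<Rightarrow> nat set \<Rightarrow> (nat \<times> nat) set \<Rightarrow> nat set" where
  "nbrs U I B = {u \<in> U. \<exists>i\<in>I. (u, i) \<in> B}"

definition next_vertex :: "nat set \<Rightarrow> nat set \<Rightarrow> nat" where
  "next_vertex A U = Min (if A = {} then U else A)"

text \<open>The attributes \<open>I\<close> of \<open>v\<close> are a separate argument, not read
  off \<open>B\<close>: the mean over one step first draws \<open>I\<close> from the row of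
  \<open>v\<close> and then needs only the columns of \<open>I\<close>.\<close>

definition process :: "nat \<Rightarrow> nat set \<Rightarrow> (nat \<times> nat) set \<Rightarrow> exploration \<Rightarrow> exploration" where
  "process v I B = (\<lambda>(A, U, J).
     (A - {v} \<union> nbrs (U - {v}) I B, U - {v} - nbrs (U - {v}) I B, J - I))"

definition step :: "(nat \<times> nat) set \<Rightarrow> exploration \<Rightarrow> exploration" where
  "step B = (\<lambda>(A, U, J). let v = next_vertex A U in process v {i \<in> J. (v, i) \<in> B} B (A, U, J))"

primrec explore :: "nat \<Rightarrow> (nat \<times> nat) set \<Rightarrow> exploration \<Rightarrow> exploration" where
  "explore 0 B s = s"
| "explore (Suc k) B s = explore k B (step B s)"

text \<open>The pairs that have not been inspected: processing \<open>v\<close> inspects the row of \<open>v\<close> and the columns of its attributes.\<close>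

definition fresh :: "exploration \<Rightarrow> (nat \<times> nat) set" where
  "fresh = (\<lambda>(A, U, J). (A \<union> U) \<times> J)"

abbreviation start :: "nat \<Rightarrow> nat \<Rightarrow> nat \<Rightarrow> exploration" where
  "start n m v \<equiv> ({v}, {..<n} - {v}, {..<m})"

section \<open>Locality of the exploration\<close>

lemma explore_Suc_step: "explore (Suc k) B s = step B (explore k B s)"
  by (induction k arbitrary: s) auto

lemma next_vertex_in:
  assumes "finite A" "finite U" "A \<union> U \<noteq> {}"
  shows "next_vertex A U \<in> A \<union> U" "A \<noteq> {} \<Longrightarrow> next_vertex A U \<in> A"
  using assms Min_in[of A] Min_in[of U] by (auto simp: next_vertex_def)

lemma process_cases:
  assumes "process v I B (A, U, J) = (A', U', J')" "A \<inter> U = {}"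
  shows "A' \<union> U' = A \<union> U - {v}" "A' \<inter> U' = {}" "J' = J - I" "U' = U - {v} - nbrs (U - {v}) I B"
  using assms by (auto simp: process_def nbrs_def)

text \<open>The processed vertex lies in \<open>A \<union> U\<close>, and only its row on
  \<open>J\<close> and columns of attributes in \<open>J\<close> at vertices of \<open>U\<close> are
  read; all these pairs are fresh.\<close>

lemma step_local:
  assumes "finite A" "finite U" "A \<union> U \<noteq> {}" "fresh (A, U, J) \<subseteq> F"
  shows "step (B \<inter> F) (A, U, J) = step B (A, U, J)"
proof -
  let ?v = "next_vertex A U"
  have "{i \<in> J. (?v, i) \<in> B \<inter> F} = {i \<in> J. (?v, i) \<in> B}"
    using next_vertex_in[OF assms(1-3)] assms(4) by (auto simp: fresh_def)
  moreover have "nbrs (U - {?v}) {i \<in> J. (?v, i) \<in> B} (B \<inter> F) = nbrs (U - {?v}) {i \<in> J. (?v, i) \<in> B} B"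
    using assms(4) by (auto simp: fresh_def nbrs_def)
  ultimately show ?thesis by (simp add: step_def process_def)
qed

text \<open>A step consumes exactly one vertex, so the bound
  \<open>k \<le> card (A \<union> U)\<close> in later lemmas ensures that \<open>k\<close> steps
  never run out of vertices.\<close>

lemma step_fresh:
  assumes "finite A" "finite U" "A \<union> U \<noteq> {}" "A \<inter> U = {}" "step B (A, U, J) = (A', U', J')"
  shows "finite A'" "finite U'" "A' \<inter> U' = {}" "card (A \<union> U) = Suc (card (A' \<union> U'))" "J' \<subseteq> J"
    "U' \<subseteq> U" "A' \<union> U' = A \<union> U - {next_vertex A U}" "fresh (A', U', J') \<subseteq> fresh (A, U, J)"
proof -
  let ?v = "next_vertex A U"
  have eq: "process ?v {i \<in> J. (?v, i) \<in> B} B (A, U, J) = (A', U', J')"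
    using assms(5) by (simp add: step_def Let_def)
  note pc = process_cases[OF eq assms(4)]
  have "finite (A' \<union> U')" using pc(1) assms by simp
  then show "finite A'" "finite U'" by auto
  show "A' \<inter> U' = {}" "J' \<subseteq> J" "U' \<subseteq> U" "A' \<union> U' = A \<union> U - {?v}" using pc by auto
  then show "fresh (A', U', J') \<subseteq> fresh (A, U, J)" unfolding fresh_def prod.case by blast
  show "card (A \<union> U) = Suc (card (A' \<union> U'))"
    unfolding pc(1) using next_vertex_in(1)[OF assms(1-3)] assms(1,2)
    by (metis card.remove finite_UnI)
qed

lemma explore_local:
  assumes "finite A" "finite U" "A \<inter> U = {}" "k \<le> card (A \<union> U)" "fresh (A, U, J) \<subseteq> F"
  shows "explore k (B \<inter> F) (A, U, J) = explore k B (A, U, J)"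
  using assms
proof (induction k arbitrary: A U J)
  case (Suc k)
  obtain A' U' J' where s: "step B (A, U, J) = (A', U', J')" by (metis surj_pair)
  have ne: "A \<union> U \<noteq> {}" using Suc.prems(4) by auto
  note sf = step_fresh[OF Suc.prems(1,2) ne Suc.prems(3) s]
  have "fresh (A', U', J') \<subseteq> F" using sf(8) Suc.prems(5) by blast
  then have "explore k (B \<inter> F) (A', U', J') = explore k B (A', U', J')"
    using sf Suc.prems by (intro Suc.IH) auto
  then show ?case using step_local[OF Suc.prems(1,2) ne Suc.prems(5)] s by simp
qed simp

lemma explore_fresh:
  assumes "finite A" "finite U" "A \<inter> U = {}" "k \<le> card (A \<union> U)"
  shows "fresh (explore k B (A, U, J)) \<subseteq> fresh (A, U, J)"
  using assms
proof (induction k arbitrary: A U J)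
  case (Suc k)
  obtain A' U' J' where s: "step B (A, U, J) = (A', U', J')" by (metis surj_pair)
  have ne: "A \<union> U \<noteq> {}" using Suc.prems(4) by auto
  note sf = step_fresh[OF Suc.prems(1,2) ne Suc.prems(3) s]
  have "fresh (explore k B (A', U', J')) \<subseteq> fresh (A', U', J')"
    using sf Suc.prems by (intro Suc.IH) auto
  also have "\<dots> \<subseteq> fresh (A, U, J)" by (rule sf(8))
  finally show ?case using s by simp
qed simp

section \<open>Means over the random bipartite graph, revealed step by step\<close>

locale random_bipartite =
  fixes p :: "nat \<Rightarrow> real"
  assumes p_nonneg: "0 \<le> p i" and p_le_1: "p i \<le> 1"
begin

abbreviation expect :: "nat set \<Rightarrow> nat set \<Rightarrow> ((nat \<times> nat) set \<Rightarrow> real) \<Rightarrow> real" where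
  "expect W J \<equiv> bexp (\<lambda>(v, i). p i) (W \<times> J)"

lemma expect_mono:
  assumes "\<And>B. B \<subseteq> W \<times> J \<Longrightarrow> f B \<le> g B"
  shows "expect W J f \<le> expect W J g"
  using assms p_nonneg p_le_1 by (intro bexp_mono) auto

lemma expect_Un:
  assumes "finite V" "finite W" "finite J" "V \<inter> W = {}"
  shows "expect (V \<union> W) J f = expect V J (\<lambda>X. expect W J (\<lambda>Y. f (X \<union> Y)))"
  unfolding Sigma_Un_distrib1 using assms by (intro bexp_union) auto

lemma expect_Un2:
  assumes "finite W" "finite I" "finite J" "I \<inter> J = {}"
  shows "expect W (I \<union> J) f = expect W I (\<lambda>X. expect W J (\<lambda>Y. f (X \<union> Y)))"
  unfolding Sigma_Un_distrib2 using assms by (intro bexp_union) auto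

lemma expect_row:
  assumes "finite J"
  shows "expect {v} J f = bexp p J (\<lambda>I. f ({v} \<times> I))"
proof -
  have eq: "{v} \<times> X = Pair v ` X" for X :: "nat set" by auto
  show ?thesis
    using bexp_image[of J "Pair v" "\<lambda>(v, i). p i" f] assms unfolding eq by (simp add: inj_on_def o_def)
qed

lemma expect_row_empty:
  assumes "finite J"
  shows "bexp p J (\<lambda>I. if I = {} then a else b) = b + (a - b) * (\<Prod>i\<in>J. 1 - p i)"
proof -
  have "bexp p J (\<lambda>I. if I = {} then a else b) =
     bexp p J (\<lambda>I. b * 1 + (a - b) * (\<Prod>i\<in>J. if i \<in> I then 0 else 1))"
  proof (intro bexp_cong refl)
    fix I assume "I \<subseteq> J"
    then have "(\<Prod>i\<in>J. if i \<in> I then 0 else 1 :: real) = of_bool (I = {})"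
      using assms by (cases "I = {}") (auto intro!: prod_zero)
    then show "(if I = {} then a else b) = b * 1 + (a - b) * (\<Prod>i\<in>J. if i \<in> I then 0 else 1)"
      by simp
  qed
  also have "\<dots> = b + (a - b) * (\<Prod>i\<in>J. 1 - p i)"
    using assms by (subst bexp_linear) (simp add: bexp_const bexp_prod)
  finally show ?thesis .
qed

text \<open>One-step Markov property. The pairs split into the row of \<open>v\<close> on
  \<open>J\<close>, the columns of \<open>I\<close> on the other vertices \<open>W\<close>, and
  \<open>W \<times> (J - I)\<close>. The first two blocks determine the step; the third is exactly
  the fresh set of the new state and is independent of them. Hypothesis \<open>loc\<close> says that
  \<open>F\<close> reads only fresh pairs.\<close>

lemma expect_step:
  assumes fin: "finite A" "finite U" "finite J" and ne: "A \<union> U \<noteq> {}"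
    and loc: "\<And>A' U' J' B. finite A' \<Longrightarrow> finite U' \<Longrightarrow> A' \<inter> U' = {} \<Longrightarrow> A' \<union> U' = A \<union> U - {next_vertex A U} \<Longrightarrow>
       F (A', U', J') (B \<inter> fresh (A', U', J')) = F (A', U', J') B"
    and dis: "A \<inter> U = {}"
  defines "v \<equiv> next_vertex A U" and "W \<equiv> A \<union> U - {next_vertex A U}"
  shows "expect (A \<union> U) J (\<lambda>B. F (step B (A, U, J)) B) =
     bexp p J (\<lambda>I. expect W I (\<lambda>Y. expect W (J - I) (F (process v I Y (A, U, J)))))"
proof -
  have v: "v \<in> A \<union> U" unfolding v_def by (intro next_vertex_in fin ne)
  have AU: "A \<union> U = {v} \<union> W" "{v} \<inter> W = {}" "finite W"
    using v fin by (auto simp: v_def W_def)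
  have "expect (A \<union> U) J (\<lambda>B. F (step B (A, U, J)) B) =
    bexp p J (\<lambda>I. expect W J (\<lambda>Y. F (step ({v} \<times> I \<union> Y) (A, U, J)) ({v} \<times> I \<union> Y)))"
    unfolding AU(1) using AU fin by (subst expect_Un) (auto simp: expect_row)
  also have "\<dots> = bexp p J (\<lambda>I. expect W I (\<lambda>Y. expect W (J - I) (F (process v I Y (A, U, J)))))"
  proof (intro bexp_cong refl)
    fix I assume I: "I \<subseteq> J"
    have J: "J = I \<union> (J - I)" using I by auto
    have fI: "finite I" using I fin finite_subset by auto
    have "expect W J (\<lambda>Y. F (step ({v} \<times> I \<union> Y) (A, U, J)) ({v} \<times> I \<union> Y)) =
        expect W I (\<lambda>Y. expect W (J - I) (\<lambda>Z. F (step ({v} \<times> I \<union> (Y \<union> Z)) (A, U, J)) ({v} \<times> I \<union> (Y \<union> Z))))"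
      using expect_Un2[of W I "J - I" "\<lambda>Y. F (step ({v} \<times> I \<union> Y) (A, U, J)) ({v} \<times> I \<union> Y)"] AU(3) fI fin(3) J
      by auto
    also have "\<dots> = expect W I (\<lambda>Y. expect W (J - I) (F (process v I Y (A, U, J))))"
    proof (intro bexp_cong refl)
      fix Y Z assume Y: "Y \<subseteq> W \<times> I" and Z: "Z \<subseteq> W \<times> (J - I)"
      let ?B = "{v} \<times> I \<union> (Y \<union> Z)"
      have 1: "{i \<in> J. (v, i) \<in> ?B} = I" using I Y Z AU(2) by auto
      have "nbrs (U - {v}) I ?B = nbrs (U - {v}) I Y" using Z by (auto simp: nbrs_def)
      then have st: "step ?B (A, U, J) = process v I Y (A, U, J)"
        using 1 by (simp add: step_def process_def v_def[symmetric])
      obtain A' U' J' where s': "process v I Y (A, U, J) = (A', U', J')" by (metis surj_pair)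
      note pc = process_cases[OF s' dis]
      have fr: "?B \<inter> fresh (A', U', J') = Z"
        using pc Y Z AU(2) by (auto simp: fresh_def W_def v_def)
      have "finite (A' \<union> U')" using pc(1) fin by simp
      then have "F (A', U', J') (?B \<inter> fresh (A', U', J')) = F (A', U', J') ?B"
        using pc by (intro loc) (auto simp: v_def)
      then show "F (step ?B (A, U, J)) ?B = F (process v I Y (A, U, J)) Z"
        unfolding st s' fr by simp
    qed
    finally show "expect W J (\<lambda>Y. F (step ({v} \<times> I \<union> Y) (A, U, J)) ({v} \<times> I \<union> Y)) =
        expect W I (\<lambda>Y. expect W (J - I) (F (process v I Y (A, U, J))))" .
  qed
  finally show ?thesis .
qed

text \<open>A bound that holds from every state over its random fresh pairs also holds at the state
  reached after \<open>k\<close> steps, because what is revealed is independent of what is still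
  fresh. The induction conditions on the first step.\<close>

lemma explore_markov:
  assumes "finite A" "finite U" "finite J" "A \<inter> U = {}" "k \<le> card (A \<union> U)"
    and loc: "\<And>A' U' J' B. \<Psi> (A', U', J') (B \<inter> fresh (A', U', J')) = \<Psi> (A', U', J') B"
    and bound: "\<And>A' U' J'. finite A' \<Longrightarrow> finite U' \<Longrightarrow> finite J' \<Longrightarrow> A' \<inter> U' = {} \<Longrightarrow>
       expect (A' \<union> U') J' (\<Psi> (A', U', J')) \<le> \<epsilon>"
  shows "expect (A \<union> U) J (\<lambda>B. \<Psi> (explore k B (A, U, J)) B) \<le> \<epsilon>"
  using assms(1-5)
proof (induction k arbitrary: A U J)
  case 0
  then show ?case using bound by simp
next
  case (Suc k)
  let ?v = "next_vertex A U"
  let ?W = "A \<union> U - {?v}"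
  have ne: "A \<union> U \<noteq> {}" using Suc.prems(5) by auto
  have "?v \<in> A \<union> U" by (intro next_vertex_in Suc.prems ne)
  then have cW: "card (A \<union> U) = Suc (card ?W)"
    using Suc.prems by (metis card.remove finite_UnI)
  have "expect (A \<union> U) J (\<lambda>B. \<Psi> (explore (Suc k) B (A, U, J)) B) =
     bexp p J (\<lambda>I. expect ?W I (\<lambda>Y. expect ?W (J - I)
       (\<lambda>B. \<Psi> (explore k B (process ?v I Y (A, U, J))) B)))"
    unfolding explore.simps
  proof (rule expect_step)
    fix A' U' J' :: "nat set" and B :: "(nat \<times> nat) set"
    let ?s = "(A', U', J')"
    assume A': "finite A'" "finite U'" "A' \<inter> U' = {}" "A' \<union> U' = ?W"
    have k: "k \<le> card (A' \<union> U')" using A'(4) cW Suc.prems(5) by auto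
    have ex: "explore k (B \<inter> fresh ?s) ?s = explore k B ?s"
      by (rule explore_local[OF A'(1-3) k]) simp
    have sub: "fresh (explore k B ?s) \<subseteq> fresh ?s"
      by (rule explore_fresh[OF A'(1-3) k])
    obtain A2 U2 J2 where e: "explore k B ?s = (A2, U2, J2)" by (metis surj_pair)
    \<comment> \<open>The fresh set only shrinks, so cutting \<open>B\<close> down to the pairs that
      are fresh now does not change what \<open>\<Psi>\<close> reads \<open>k\<close> steps
      later.\<close>
    have "\<Psi> (A2, U2, J2) (B \<inter> fresh ?s) = \<Psi> (A2, U2, J2) (B \<inter> fresh ?s \<inter> fresh (A2, U2, J2))"
      by (rule loc[symmetric])
    also have "B \<inter> fresh ?s \<inter> fresh (A2, U2, J2) = B \<inter> fresh (A2, U2, J2)"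
      using sub e by auto
    also have "\<Psi> (A2, U2, J2) \<dots> = \<Psi> (A2, U2, J2) B" by (rule loc)
    finally show "\<Psi> (explore k (B \<inter> fresh ?s) ?s) (B \<inter> fresh ?s) = \<Psi> (explore k B ?s) B"
      unfolding ex e .
  qed (use Suc.prems ne in auto)
  also have "\<dots> \<le> bexp p J (\<lambda>I. expect ?W I (\<lambda>Y. \<epsilon>))"
  proof (intro bexp_mono expect_mono)
    fix I Y assume I: "I \<subseteq> J"
    obtain A' U' J' where s': "process ?v I Y (A, U, J) = (A', U', J')" by (metis surj_pair)
    note pc = process_cases[OF s' Suc.prems(4)]
    have "finite (A' \<union> U')" "finite J'" using pc Suc.prems by auto
    then have "expect (A' \<union> U') J' (\<lambda>B. \<Psi> (explore k B (A', U', J')) B) \<le> \<epsilon>"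
      using pc cW Suc.prems(5) by (intro Suc.IH) auto
    then show "expect ?W (J - I) (\<lambda>B. \<Psi> (explore k B (process ?v I Y (A, U, J))) B) \<le> \<epsilon>"
      unfolding s' pc(1,3) .
  qed (use p_nonneg p_le_1 in auto)
  also have "\<dots> = bexp p J (\<lambda>I. \<epsilon>)"
    using Suc.prems by (intro bexp_cong refl bexp_const) (auto intro: finite_subset)
  also have "\<dots> = \<epsilon>" using Suc.prems by (intro bexp_const)
  finally show ?case .
qed

text \<open>Vertices avoid all of \<open>I\<close> independently, each with probability
  \<open>\<Prod>i\<in>I. 1 - p i\<close>, so the number of vertices left in \<open>V\<close> is
  binomial; this is its generating function at \<open>1 + z\<close>. The induction exposes one row
  of \<open>W\<close> at a time, and rows outside \<open>V\<close> contribute a factor 1.\<close>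

lemma expect_avoid_power:
  assumes "finite W" "finite I" "V \<subseteq> W"
  shows "expect W I (\<lambda>Y. (1 + z) ^ card (V - nbrs V I Y)) = (1 + z * (\<Prod>i\<in>I. 1 - p i)) ^ card V"
  using assms
proof (induction W arbitrary: V)
  case empty
  then show ?case by (simp add: nbrs_def)
next
  case (insert u W)
  let ?V = "V - {u}"
  have fV: "finite ?V" using insert finite_subset by (metis finite_Diff finite_insert)
  have "expect (insert u W) I (\<lambda>Y. (1 + z) ^ card (V - nbrs V I Y)) =
     bexp p I (\<lambda>X. expect W I (\<lambda>Y. (1 + z) ^ card (V - nbrs V I ({u} \<times> X \<union> Y))))"
    using expect_Un[of "{u}" W I] insert by (simp add: expect_row)
  also have "\<dots> = bexp p I (\<lambda>X. (if u \<in> V \<and> X = {} then 1 + z else 1) * expect W I (\<lambda>Y. (1 + z) ^ card (?V - nbrs ?V I Y)))"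
    unfolding bexp_cmult[symmetric]
  proof (intro bexp_cong refl)
    fix X Y assume X: "X \<subseteq> I" "Y \<subseteq> W \<times> I"
    have "V - nbrs V I ({u} \<times> X \<union> Y) =
      (if u \<in> V \<and> X = {} then insert u (?V - nbrs ?V I Y) else ?V - nbrs ?V I Y)"
      using X insert.hyps by (auto simp: nbrs_def)
    then show "(1 + z) ^ card (V - nbrs V I ({u} \<times> X \<union> Y)) =
       (if u \<in> V \<and> X = {} then 1 + z else 1) * (1 + z) ^ card (?V - nbrs ?V I Y)"
      using fV by simp
  qed
  also have "\<dots> = bexp p I (\<lambda>X. if u \<in> V \<and> X = {} then 1 + z else 1) *
      (1 + z * (\<Prod>i\<in>I. 1 - p i)) ^ card ?V"
    using insert.prems insert.hyps by (subst insert.IH) (auto simp: bexp_mult_const)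
  also have "\<dots> = (1 + z * (\<Prod>i\<in>I. 1 - p i)) ^ card V"
  proof (cases "u \<in> V")
    case True
    then have c: "card V = Suc (card ?V)" using fV by (metis card.remove finite_Diff2 finite.emptyI finite_insert)
    have "bexp p I (\<lambda>X. if u \<in> V \<and> X = {} then 1 + z else 1) = 1 + z * (\<Prod>i\<in>I. 1 - p i)"
      using True expect_row_empty[of I "1 + z" 1] insert.prems by simp
    then show ?thesis by (simp only: c power_Suc)
  next
    case False
    then show ?thesis using insert.prems(1) by (simp add: bexp_const)
  qed
  finally show ?case .
qed

text \<open>
  Every processed vertex reveals a fresh row, so each attribute is still unused after \<open>k\<close> steps with
  probability \<open>(1 - p i) ^ k\<close>; a vertex can be undiscovered only if it has none of the used ones.
\<close>

lemma explore_moment: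
  assumes "finite A" "finite U" "finite J" "A \<inter> U = {}" "k \<le> card (A \<union> U)" and y: "y \<ge> 0" and g: "\<And>R. 0 \<le> g R"
  shows "expect (A \<union> U) J (\<lambda>B. case explore k B (A, U, J) of (A', U', J') \<Rightarrow> (1 + y) ^ card U' * g J')
     \<le> bexp (\<lambda>i. (1 - p i) ^ k) J (\<lambda>R. (1 + y * (\<Prod>i\<in>J - R. 1 - p i)) ^ card U * g R)"
  using assms(1-5)
proof (induction k arbitrary: A U J)
  case 0
  then show ?case by (simp add: bexp_const bexp_one)
next
  case (Suc k)
  let ?v = "next_vertex A U"
  let ?W = "A \<union> U - {?v}"
  let ?f = "\<lambda>(A' :: nat set, U' :: nat set, J'). (1 + y) ^ card U' * g J'"
  let ?h = "\<lambda>J R. (1 + y * (\<Prod>i\<in>J - R. 1 - p i)) ^ card U * g R"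
  have ne: "A \<union> U \<noteq> {}" using Suc.prems(5) by auto
  have "?v \<in> A \<union> U" by (intro next_vertex_in Suc.prems ne)
  then have cW: "card (A \<union> U) = Suc (card ?W)"
    using Suc.prems by (metis card.remove finite_UnI)
  have pi: "0 \<le> (\<Prod>i\<in>I. 1 - p i)" for I using p_le_1 by (intro prod_nonneg) auto
  have "expect (A \<union> U) J (\<lambda>B. ?f (explore (Suc k) B (A, U, J))) =
     bexp p J (\<lambda>I. expect ?W I (\<lambda>Y. expect ?W (J - I)
       (\<lambda>B. ?f (explore k B (process ?v I Y (A, U, J))))))"
    unfolding explore.simps
  proof (rule expect_step)
    fix A' U' J' :: "nat set" and B :: "(nat \<times> nat) set"
    let ?s = "(A', U', J')"
    assume A': "finite A'" "finite U'" "A' \<inter> U' = {}" "A' \<union> U' = ?W"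
    have k: "k \<le> card (A' \<union> U')" using A'(4) cW Suc.prems(5) by auto
    have "explore k (B \<inter> fresh ?s) ?s = explore k B ?s"
      by (rule explore_local[OF A'(1-3) k]) simp
    then show "?f (explore k (B \<inter> fresh ?s) ?s) = ?f (explore k B ?s)" by simp
  qed (use Suc.prems ne in auto)
  also have "\<dots> \<le> bexp p J (\<lambda>I. bexp (\<lambda>i. (1 - p i) ^ k) (J - I) (?h J))"
  proof (rule bexp_mono)
    fix I assume I: "I \<subseteq> J"
    have fI: "finite I" "finite (J - I)" using I Suc.prems finite_subset by auto
    let ?z = "\<lambda>R. y * (\<Prod>i\<in>J - I - R. 1 - p i)"
    let ?V = "U - {?v}"
    have "expect ?W I (\<lambda>Y. expect ?W (J - I) (\<lambda>B. ?f (explore k B (process ?v I Y (A, U, J))))) \<le>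
       expect ?W I (\<lambda>Y. bexp (\<lambda>i. (1 - p i) ^ k) (J - I) (\<lambda>R. (1 + ?z R) ^ card (?V - nbrs ?V I Y) * g R))"
    proof (rule expect_mono)
      fix Y
      obtain A' U' J' where s': "process ?v I Y (A, U, J) = (A', U', J')" by (metis surj_pair)
      note pc = process_cases[OF s' Suc.prems(4)]
      have "finite (A' \<union> U')" "finite J'" using pc Suc.prems by auto
      then have "expect (A' \<union> U') J' (\<lambda>B. ?f (explore k B (A', U', J'))) \<le>
         bexp (\<lambda>i. (1 - p i) ^ k) J' (\<lambda>R. (1 + y * (\<Prod>i\<in>J' - R. 1 - p i)) ^ card U' * g R)"
        using pc cW Suc.prems(5) by (intro Suc.IH) auto
      then show "expect ?W (J - I) (\<lambda>B. ?f (explore k B (process ?v I Y (A, U, J)))) \<le>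
          bexp (\<lambda>i. (1 - p i) ^ k) (J - I) (\<lambda>R. (1 + ?z R) ^ card (?V - nbrs ?V I Y) * g R)"
        unfolding s' pc(1,3,4)[symmetric] .
    qed
    also have "\<dots> = bexp (\<lambda>i. (1 - p i) ^ k) (J - I) (\<lambda>R. expect ?W I (\<lambda>Y. g R * (1 + ?z R) ^ card (?V - nbrs ?V I Y)))"
      by (subst bexp_swap) (simp add: mult.commute)
    \<comment> \<open>Averaging over the columns of \<open>I\<close> puts the factor
      \<open>\<Prod>i\<in>I. 1 - p i\<close> into the base; with the product over
      \<open>J - I - R\<close> it forms the product over all used attributes
      \<open>J - R\<close>.\<close>
    also have "\<dots> = bexp (\<lambda>i. (1 - p i) ^ k) (J - I) (\<lambda>R. g R * (1 + ?z R * (\<Prod>i\<in>I. 1 - p i)) ^ card ?V)"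
      unfolding bexp_cmult using fI Suc.prems
      by (intro bexp_cong refl arg_cong2[of _ _ _ _ "(*)"] expect_avoid_power) auto
    also have "\<dots> \<le> bexp (\<lambda>i. (1 - p i) ^ k) (J - I) (?h J)"
    proof (rule bexp_mono)
      fix R assume R: "R \<subseteq> J - I"
      have "J - R = (J - I - R) \<union> I" using R I by auto
      then have "(\<Prod>i\<in>J - R. 1 - p i) = (\<Prod>i\<in>J - I - R. 1 - p i) * (\<Prod>i\<in>I. 1 - p i)"
        using fI by (simp add: prod.union_disjoint[symmetric] Int_commute Diff_Int_distrib)
      then have eq: "(1 + ?z R * (\<Prod>i\<in>I. 1 - p i)) = 1 + y * (\<Prod>i\<in>J - R. 1 - p i)"
        by (simp only: mult.assoc)
      \<comment> \<open>\<open>?V\<close> lacks the processed vertex if that was undiscovered; as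
        the base is at least 1, returning to \<open>U\<close> only enlarges the power.\<close>
      have "(1 + y * (\<Prod>i\<in>J - R. 1 - p i)) ^ card ?V \<le> (1 + y * (\<Prod>i\<in>J - R. 1 - p i)) ^ card U"
        using y pi Suc.prems by (intro power_increasing card_mono) auto
      then show "g R * (1 + ?z R * (\<Prod>i\<in>I. 1 - p i)) ^ card ?V \<le> ?h J R"
        unfolding eq mult.commute[of "g R"] using g by (intro mult_right_mono)
    qed (use p_nonneg p_le_1 in \<open>auto intro: power_le_one\<close>)
    finally show "expect ?W I (\<lambda>Y. expect ?W (J - I) (\<lambda>B. ?f (explore k B (process ?v I Y (A, U, J))))) \<le>
       bexp (\<lambda>i. (1 - p i) ^ k) (J - I) (?h J)" .
  qed (use p_nonneg p_le_1 in auto)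
  also have "\<dots> = bexp (\<lambda>i. (1 - p i) ^ Suc k) J (?h J)"
    using Suc.prems by (simp add: bexp_thin)
  finally show ?case .
qed

end

section \<open>Exponential moment bounds\<close>

lemma one_minus_exp_ge:
  fixes z :: real
  assumes "0 \<le> z" "z \<le> d"
  shows "z * (1 - d / 2) \<le> 1 - exp (- z)"
proof -
  \<comment> \<open>The product equals \<open>1 + z ^ 4 / 4\<close>; this turns the quadratic lower
    bound on \<open>exp z\<close> into an upper bound on \<open>exp (- z)\<close>.\<close>
  have "1 \<le> (1 + z + z\<^sup>2 / 2) * (1 - z + z\<^sup>2 / 2)"
    using assms(1) by (simp add: algebra_simps power2_eq_square)
  also have "\<dots> \<le> exp z * (1 - z + z\<^sup>2 / 2)"
  proof (rule mult_right_mono)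
    show "1 + z + z\<^sup>2 / 2 \<le> exp z" using exp_lower_Taylor_quadratic assms by blast
    have "0 \<le> (1 - z)\<^sup>2 + 1" by simp
    then show "0 \<le> 1 - z + z\<^sup>2 / 2" by (simp add: power2_eq_square algebra_simps)
  qed
  finally have "exp (- z) \<le> 1 - z + z\<^sup>2 / 2"
    by (simp add: exp_minus field_simps)
  moreover have "z * z \<le> z * d" using assms by (intro mult_left_mono)
  ultimately show ?thesis by (simp add: algebra_simps power2_eq_square)
qed

context random_bipartite
begin

text \<open>The second condition leaves at least \<open>b * k\<close> discovered vertices after
  \<open>k\<close> steps; \<open>k\<close> of them are processed, so at least
  \<open>(b - 1) * k\<close> are active.\<close>

definition typical :: "nat \<Rightarrow> nat \<Rightarrow> real \<Rightarrow> real \<Rightarrow> nat \<Rightarrow> exploration \<Rightarrow> bool" where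
  "typical n m a b k = (\<lambda>(A, U, J). a * k / n \<le> (\<Sum>i\<in>{..<m} - J. p i) \<and> real (card U) \<le> real n - b * real k)"

lemma prod_le_exp_sum: "(\<Prod>i\<in>I. 1 - p i) \<le> exp (- (\<Sum>i\<in>I. p i))"
proof (cases "finite I")
  case True
  have "(\<Prod>i\<in>I. 1 - p i) \<le> (\<Prod>i\<in>I. exp (- p i))"
    using p_le_1 exp_ge_add_one_self[of "- p i" for i] by (intro prod_mono) auto
  then show ?thesis using True by (simp add: exp_sum[symmetric] sum_negf)
qed simp

lemma used_mass_mgf:
  assumes J: "finite J" and l: "0 \<le> l" "\<And>i. i \<in> J \<Longrightarrow> l * p i \<le> t" and k: "\<And>i. i \<in> J \<Longrightarrow> real k * p i \<le> d"
    and "t \<le> 1" "d \<le> 1"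
  shows "bexp (\<lambda>i. (1 - p i) ^ k) J (\<lambda>R. exp (- l * (\<Sum>i\<in>J - R. p i)))
     \<le> exp (- (l * k * (1 - d / 2) * (1 - t / 2) * (\<Sum>i\<in>J. (p i)\<^sup>2)))"
proof -
  have "bexp (\<lambda>i. (1 - p i) ^ k) J (\<lambda>R. exp (- l * (\<Sum>i\<in>J - R. p i))) =
     bexp (\<lambda>i. (1 - p i) ^ k) J (\<lambda>R. \<Prod>i\<in>J. if i \<in> R then 1 else exp (- l * p i))"
  proof (intro bexp_cong refl)
    fix R assume "R \<subseteq> J"
    have "exp (- l * (\<Sum>i\<in>J - R. p i)) = (\<Prod>i\<in>J - R. exp (- l * p i))"
      using J by (simp add: exp_sum[symmetric] sum_distrib_left sum_negf)
    also have "\<dots> = (\<Prod>i\<in>J. if i \<in> R then 1 else exp (- l * p i))"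
      using J by (intro prod.mono_neutral_cong_left) auto
    finally show "exp (- l * (\<Sum>i\<in>J - R. p i)) = (\<Prod>i\<in>J. if i \<in> R then 1 else exp (- l * p i))" .
  qed
  also have "\<dots> = (\<Prod>i\<in>J. (1 - p i) ^ k * 1 + (1 - (1 - p i) ^ k) * exp (- l * p i))"
    using J by (rule bexp_prod)
  also have "\<dots> \<le> (\<Prod>i\<in>J. exp (- (l * k * (1 - d / 2) * (1 - t / 2) * (p i)\<^sup>2)))"
  proof (intro prod_mono conjI)
    fix i assume i: "i \<in> J"
    have r: "0 \<le> (1 - p i) ^ k" "(1 - p i) ^ k \<le> 1" using p_nonneg p_le_1 by (auto intro: power_le_one)
    then show "0 \<le> (1 - p i) ^ k * 1 + (1 - (1 - p i) ^ k) * exp (- l * p i)" by simp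
    have "(1 - p i) ^ k \<le> exp (- p i) ^ k"
      using p_le_1 exp_ge_add_one_self[of "- p i"] by (intro power_mono) auto
    also have "\<dots> = exp (- (real k * p i))" by (simp add: exp_of_nat_mult[symmetric])
    finally have 1: "real k * p i * (1 - d / 2) \<le> 1 - (1 - p i) ^ k"
      using one_minus_exp_ge[of "real k * p i" d] k[OF i] p_nonneg[of i] by simp
    have 2: "l * p i * (1 - t / 2) \<le> 1 - exp (- (l * p i))"
      using l i p_nonneg[of i] by (intro one_minus_exp_ge) auto
    have "(1 - p i) ^ k * 1 + (1 - (1 - p i) ^ k) * exp (- l * p i) =
        1 + - ((1 - (1 - p i) ^ k) * (1 - exp (- (l * p i))))" by (simp add: algebra_simps)
    also have "\<dots> \<le> exp (- ((1 - (1 - p i) ^ k) * (1 - exp (- (l * p i)))))"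
      by (rule exp_ge_add_one_self)
    also have "\<dots> \<le> exp (- ((real k * p i * (1 - d / 2)) * (l * p i * (1 - t / 2))))"
      unfolding exp_le_cancel_iff neg_le_iff_le using 1 2 p_nonneg[of i] assms r
      by (intro mult_mono) auto
    also have "\<dots> = exp (- (l * k * (1 - d / 2) * (1 - t / 2) * (p i)\<^sup>2))"
      by (simp add: power2_eq_square mult_ac)
    finally show "(1 - p i) ^ k * 1 + (1 - (1 - p i) ^ k) * exp (- l * p i) \<le>
       exp (- (l * k * (1 - d / 2) * (1 - t / 2) * (p i)\<^sup>2))" .
  qed
  also have "\<dots> = exp (- (l * k * (1 - d / 2) * (1 - t / 2) * (\<Sum>i\<in>J. (p i)\<^sup>2)))"
    using J by (simp add: exp_sum[symmetric] sum_distrib_left sum_negf)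
  finally show ?thesis .
qed

text \<open>Chernoff bound for at least \<open>n - x\<close> undiscovered vertices when each is
  undiscovered with probability \<open>exp (- q)\<close>. Moving \<open>exp (- t)\<close> into each
  of the \<open>n\<close> factors counts discovered vertices instead, which brings the exponent to
  order \<open>n * q\<close>.\<close>

lemma undiscovered_mgf:
  fixes n N k :: nat
  assumes t: "0 \<le> t" "t \<le> 1" and q: "0 \<le> q" "q \<le> d" "d \<le> 1" and N: "N \<le> n"
  shows "exp (- t * (real n - x)) * (1 + (exp t - 1) * exp (- q)) ^ N
     \<le> exp (t * x - n * (t * (1 - t / 2)) * (q * (1 - d / 2)))"
proof -
  have "exp (- t * (real n - x)) * (1 + (exp t - 1) * exp (- q)) ^ N \<le>
     exp (- t * (real n - x)) * (1 + (exp t - 1) * exp (- q)) ^ n"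
    using N t by (intro mult_left_mono power_increasing) auto
  also have "\<dots> = exp (t * x) * (exp (- t) * (1 + (exp t - 1) * exp (- q))) ^ n"
  proof -
    have "exp (- t * (real n - x)) = exp (t * x) * exp (- t) ^ n"
      by (simp add: exp_of_nat_mult[symmetric] exp_add[symmetric] algebra_simps)
    then show ?thesis by (simp only: power_mult_distrib mult.assoc)
  qed
  also have "exp (- t) * (1 + (exp t - 1) * exp (- q)) = 1 + - ((1 - exp (- t)) * (1 - exp (- q)))"
    by (simp add: algebra_simps exp_minus)
  also have "exp (t * x) * (1 + - ((1 - exp (- t)) * (1 - exp (- q)))) ^ n \<le>
     exp (t * x) * exp (- ((1 - exp (- t)) * (1 - exp (- q)))) ^ n"
  proof (intro mult_left_mono power_mono exp_ge_add_one_self)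
    have "(1 - exp (- t)) * (1 - exp (- q)) \<le> 1 * 1"
      using t q by (intro mult_mono) auto
    then show "0 \<le> 1 + - ((1 - exp (- t)) * (1 - exp (- q)))" by simp
  qed simp
  also have "\<dots> = exp (t * x - n * ((1 - exp (- t)) * (1 - exp (- q))))"
    by (simp add: exp_of_nat_mult[symmetric] exp_add[symmetric])
  also have "\<dots> \<le> exp (t * x - n * ((t * (1 - t / 2)) * (q * (1 - d / 2))))"
    using one_minus_exp_ge[of t t] one_minus_exp_ge[of q d] t q
    by (simp del: exp_le_cancel_iff add: exp_le_cancel_iff) (intro mult_left_mono mult_mono; simp)
  finally show ?thesis by (simp add: mult.assoc)
qed

text \<open>If the state is not typical, either the used mass is too small, or it suffices and still
  too many vertices are undiscovered. Each case is bounded by an exponential moment from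
  \<open>explore_moment\<close>; the slack \<open>\<eta>\<close> in \<open>C1\<close> and
  \<open>C2\<close> survives in the exponent.\<close>

lemma explore_bad_prob:
  fixes n m k v :: nat and s a b c d t \<eta> :: real
  assumes v: "v < n" and k: "real k \<le> d * s" and s: "0 < s" "s \<le> n" "\<And>i. i < m \<Longrightarrow> p i * s \<le> 1"
    and sum: "real n * (\<Sum>i<m. (p i)\<^sup>2) = c"
    and t: "0 \<le> t" "t \<le> 1" and d: "0 \<le> d" "d \<le> 1" "a * d \<le> 1" and a: "0 \<le> a"
    and C1: "a + \<eta> \<le> c * (1 - d / 2) * (1 - t / 2)"
    and C2: "b + \<eta> \<le> (1 - t / 2) * a * (1 - a * d / 2)" and \<eta>: "0 \<le> \<eta>"
  shows "expect {..<n} {..<m} (\<lambda>B. of_bool (\<not> typical n m a b k (explore k B (start n m v)))) \<le> 2 * exp (- (t * \<eta> * k * s / n))"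
proof -
  have n: "0 < n" using v by auto
  define q where "q = a * k / n"
  let ?s0 = "({v}, {..<n} - {v}, {..<m})"
  let ?X = "\<lambda>J. \<Sum>i\<in>{..<m} - J. p i"
  let ?r = "\<lambda>i. (1 - p i) ^ k"
  have vn: "{v} \<union> ({..<n} - {v}) = {..<n}" using v by auto
  have "d * s \<le> 1 * real n" using d s by (intro mult_mono) auto
  then have kn: "k \<le> n" using k by simp
  have moment: "expect {..<n} {..<m} (\<lambda>B. case explore k B ?s0 of (A', U', J') \<Rightarrow> (1 + y) ^ card U' * g J')
     \<le> bexp ?r {..<m} (\<lambda>R. (1 + y * (\<Prod>i\<in>{..<m} - R. 1 - p i)) ^ (n - 1) * g R)"
    if "0 \<le> y" "\<And>R. 0 \<le> g R" for y g
    using explore_moment[of "{v}" "{..<n} - {v}" "{..<m}" k y g] that kn v unfolding vn by simp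
  \<comment> \<open>\<open>?f1\<close> takes \<open>y = 0\<close> and tilts the mass by
    \<open>t * s\<close>, so that \<open>p i * s \<le> 1\<close> keeps each summand at most
    \<open>t\<close>. \<open>?f2\<close> takes \<open>1 + y = exp t\<close>.\<close>
  let ?f1 = "\<lambda>(A :: nat set, U :: nat set, J). (1 + 0) ^ card U * exp (t * s * (q - ?X J))"
  let ?f2 = "\<lambda>(A :: nat set, U :: nat set, J). (1 + (exp t - 1)) ^ card U *
      (exp (- t * (real n - b * k)) * of_bool (q \<le> ?X J))"
  have "expect {..<n} {..<m} (\<lambda>B. of_bool (\<not> typical n m a b k (explore k B ?s0))) \<le>
     expect {..<n} {..<m} (\<lambda>B. 1 * ?f1 (explore k B ?s0) + 1 * ?f2 (explore k B ?s0))"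
  proof (rule expect_mono)
    fix B
    obtain A U J where e: "explore k B ?s0 = (A, U, J)" by (metis surj_pair)
    show "of_bool (\<not> typical n m a b k (explore k B ?s0)) \<le>
      1 * ?f1 (explore k B ?s0) + 1 * ?f2 (explore k B ?s0)"
    proof (cases "q \<le> ?X J")
      case False
      then have "0 \<le> t * s * (q - ?X J)" using t s by simp
      then have "1 \<le> exp (t * s * (q - ?X J))" by simp
      then show ?thesis unfolding e by (simp add: typical_def q_def[symmetric] add_increasing2)
    next
      case True
      have "1 \<le> exp t ^ card U * exp (- t * (real n - b * k))" if "\<not> card U \<le> n - b * k"
      proof -
        have "0 \<le> t * (card U - (real n - b * k))" using that t by simp
        then have "1 \<le> exp (t * (card U - (real n - b * k)))" by simp
        also have "\<dots> = exp t ^ card U * exp (- t * (real n - b * k))"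
          by (simp add: exp_of_nat_mult[symmetric] exp_add[symmetric] algebra_simps)
        finally show ?thesis .
      qed
      then show ?thesis unfolding e using True by (auto simp: typical_def q_def[symmetric] intro!: add_nonneg_nonneg add_increasing)
    qed
  qed
  also have "\<dots> = expect {..<n} {..<m} (\<lambda>B. ?f1 (explore k B ?s0)) + expect {..<n} {..<m} (\<lambda>B. ?f2 (explore k B ?s0))"
    unfolding bexp_linear by simp
  also have "\<dots> \<le> exp (- (t * \<eta> * k * s / n)) + exp (- (t * \<eta> * k * s / n))"
  proof (rule add_mono)
    have "expect {..<n} {..<m} (\<lambda>B. ?f1 (explore k B ?s0)) \<le>
      bexp ?r {..<m} (\<lambda>R. exp (t * s * q) * exp (- (t * s) * ?X R))"
      using moment[of 0 "\<lambda>J. exp (t * s * (q - ?X J))"]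
      by (simp add: exp_add[symmetric] algebra_simps)
    also have "\<dots> \<le> exp (t * s * q) * exp (- ((t * s) * k * (1 - d / 2) * (1 - t / 2) * (\<Sum>i<m. (p i)\<^sup>2)))"
      unfolding bexp_cmult
    proof (intro mult_left_mono used_mass_mgf)
      fix i assume i: "i \<in> {..<m}"
      have "t * (p i * s) \<le> t * 1" using s(3) i t by (intro mult_left_mono) auto
      then show "t * s * p i \<le> t" by (simp add: mult_ac)
      have "real k * p i \<le> d * s * p i" using k p_nonneg by (intro mult_right_mono)
      also have "\<dots> = d * (p i * s)" by simp
      also have "\<dots> \<le> d * 1" using s(3) i d by (intro mult_left_mono) auto
      finally show "real k * p i \<le> d" by simp
    qed (use t s d in auto)
    \<comment> \<open>The hypothesis on the sum of squares enters here: up to the factors with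
      \<open>d\<close> and \<open>t\<close>, the mean used mass is \<open>c * k / n\<close>, above
      the threshold \<open>a * k / n\<close>.\<close>
    also have "(\<Sum>i<m. (p i)\<^sup>2) = c / n" using sum n by (simp add: field_simps)
    also have "exp (t * s * q) * exp (- ((t * s) * k * (1 - d / 2) * (1 - t / 2) * (c / n))) =
       exp (- (t * s * k / n * (c * (1 - d / 2) * (1 - t / 2) - a)))"
      unfolding exp_add[symmetric] q_def by (simp add: algebra_simps)
    also have "\<dots> \<le> exp (- (t * s * k / n * \<eta>))"
      unfolding exp_le_cancel_iff neg_le_iff_le using C1 t s by (intro mult_left_mono) auto
    finally show "expect {..<n} {..<m} (\<lambda>B. ?f1 (explore k B ?s0)) \<le> exp (- (t * \<eta> * k * s / n))"
      by (simp add: mult_ac)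
  next
    have "expect {..<n} {..<m} (\<lambda>B. ?f2 (explore k B ?s0)) \<le>
      bexp ?r {..<m} (\<lambda>R. (1 + (exp t - 1) * (\<Prod>i\<in>{..<m} - R. 1 - p i)) ^ (n - 1) *
         (exp (- t * (real n - b * k)) * of_bool (q \<le> ?X R)))"
      by (rule moment) (use t in auto)
    also have "\<dots> \<le> bexp ?r {..<m} (\<lambda>R. exp (- t * (real n - b * k)) * (1 + (exp t - 1) * exp (- q)) ^ (n - 1))"
    proof (rule bexp_mono)
      fix R :: "nat set"
      have pi: "0 \<le> (\<Prod>i\<in>{..<m} - R. 1 - p i)" using p_le_1 by (intro prod_nonneg) auto
      show "(1 + (exp t - 1) * (\<Prod>i\<in>{..<m} - R. 1 - p i)) ^ (n - 1) *
         (exp (- t * (real n - b * k)) * of_bool (q \<le> ?X R)) \<le>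
         exp (- t * (real n - b * k)) * (1 + (exp t - 1) * exp (- q)) ^ (n - 1)"
      proof (cases "q \<le> ?X R")
        case True
        have "(\<Prod>i\<in>{..<m} - R. 1 - p i) \<le> exp (- ?X R)" by (rule prod_le_exp_sum)
        also have "\<dots> \<le> exp (- q)" using True by simp
        finally have "(1 + (exp t - 1) * (\<Prod>i\<in>{..<m} - R. 1 - p i)) ^ (n - 1) \<le>
           (1 + (exp t - 1) * exp (- q)) ^ (n - 1)"
          using t pi by (intro power_mono add_left_mono mult_left_mono) auto
        then show ?thesis using True by simp
      qed (use t in simp)
    qed (use p_nonneg p_le_1 in \<open>auto intro: power_le_one\<close>)
    also have "\<dots> = exp (- t * (real n - b * k)) * (1 + (exp t - 1) * exp (- q)) ^ (n - 1)"
      by (simp add: bexp_const)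
    also have "\<dots> \<le> exp (t * (b * k) - n * (t * (1 - t / 2)) * (q * (1 - a * d / 2)))"
    proof (rule undiscovered_mgf)
      have "q \<le> a * (d * s) / n" unfolding q_def using k a n by (intro divide_right_mono mult_left_mono) auto
      also have "\<dots> = a * d * (s / n)" by simp
      also have "\<dots> \<le> a * d * 1" using a d s n by (intro mult_left_mono) auto
      finally show "q \<le> a * d" by simp
    qed (use t d a in \<open>auto simp: q_def\<close>)
    also have "n * (t * (1 - t / 2)) * (q * (1 - a * d / 2)) = (n * q) * ((t * (1 - t / 2)) * (1 - a * d / 2))"
      by (simp only: mult_ac)
    also have "n * q = a * k" unfolding q_def using n by simp
    also have "exp (t * (b * k) - a * k * ((t * (1 - t / 2)) * (1 - a * d / 2))) =
        exp (- (t * k * ((1 - t / 2) * a * (1 - a * d / 2) - b)))"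
      by (simp add: right_diff_distrib mult_ac)
    also have "\<dots> \<le> exp (- (t * k * \<eta>))"
      unfolding exp_le_cancel_iff neg_le_iff_le using C2 t by (intro mult_left_mono) auto
    \<comment> \<open>By \<open>s \<le> n\<close> this weakens to the same exponent as in the first
      case.\<close>
    also have "\<dots> \<le> exp (- (t * k * \<eta> * (s / n)))"
      unfolding exp_le_cancel_iff neg_le_iff_le using t \<eta> s n by (intro mult_right_le_one_le mult_nonneg_nonneg) auto
    finally show "expect {..<n} {..<m} (\<lambda>B. ?f2 (explore k B ?s0)) \<le> exp (- (t * \<eta> * k * s / n))"
      by (simp add: mult_ac)
  qed
  finally show ?thesis by simp
qed

end

section \<open>Components\<close>

text \<open>The intersection graph cut down to vertices \<open>U\<close> and attributes
  \<open>J\<close>; with \<open>{..<n}\<close> and \<open>{..<m}\<close> it is the full graph. The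
  cut-down version reads only rows of \<open>U\<close>, which gives independence from the other
  rows.\<close>

definition shared :: "nat set \<Rightarrow> nat set \<Rightarrow> (nat \<times> nat) set \<Rightarrow> (nat \<times> nat) set" where
  "shared U J B = {(u, v). u \<in> U \<and> v \<in> U \<and> u \<noteq> v \<and> (\<exists>i\<in>J. (u, i) \<in> B \<and> (v, i) \<in> B)}"

definition touched :: "nat set \<Rightarrow> nat set \<Rightarrow> (nat \<times> nat) set \<Rightarrow> nat \<Rightarrow> nat set" where
  "touched U J B w = {i \<in> J. \<exists>u\<in>U. (w, u) \<in> (shared U J B)\<^sup>* \<and> (u, i) \<in> B}"

lemma sym_shared: "sym (shared U J B)"
  by (auto simp: shared_def sym_def)

lemma shared_mono: "U \<subseteq> U' \<Longrightarrow> J \<subseteq> J' \<Longrightarrow> shared U J B \<subseteq> shared U' J' B"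
  by (auto simp: shared_def)

lemma intersection_edges_shared: "intersection_edges n m B = shared {..<n} {..<m} {x. B x}"
  by (auto simp: intersection_edges_def shared_def)

lemma shared_rtrancl_sym: "(x, y) \<in> (shared U J B)\<^sup>* \<Longrightarrow> (y, x) \<in> (shared U J B)\<^sup>*"
  using sym_rtrancl[OF sym_shared] by (auto simp: sym_def)

lemma explore_invariant:
  assumes "v < n" "k \<le> n" "explore k B (start n m v) = (A, U, J)"
  shows "A \<subseteq> {..<n} \<and> U \<subseteq> {..<n} - {v} \<and> A \<inter> U = {} \<and> J \<subseteq> {..<m} \<and> card (A \<union> U) = n - k \<and>
     (\<forall>d\<in>{..<n} - (A \<union> U). \<forall>i\<in>J. (d, i) \<notin> B) \<and>
     (\<forall>i\<in>{..<m} - J. \<forall>u\<in>U. (u, i) \<notin> B) \<and>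
     (\<forall>i\<in>{..<m} - J. \<exists>d\<in>{..<n} - (A \<union> U). (d, i) \<in> B) \<and>
     (\<forall>x\<in>A. \<forall>y\<in>A. (x, y) \<in> (shared {..<n} {..<m} B)\<^sup>*)"
  using assms(2,3)
proof (induction k arbitrary: A U J)
  case 0
  then have "A \<union> U = {..<n}" using assms(1) by auto
  then show ?case using 0 assms(1) by auto
next
  case (Suc k)
  obtain A1 U1 J1 where s: "explore k B (start n m v) = (A1, U1, J1)" by (metis surj_pair)
  have IH: "A1 \<subseteq> {..<n}" "U1 \<subseteq> {..<n} - {v}" "A1 \<inter> U1 = {}" "J1 \<subseteq> {..<m}" "card (A1 \<union> U1) = n - k"
    "\<And>d i. d \<in> {..<n} - (A1 \<union> U1) \<Longrightarrow> i \<in> J1 \<Longrightarrow> (d, i) \<notin> B"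
    "\<And>i u. i \<in> {..<m} - J1 \<Longrightarrow> u \<in> U1 \<Longrightarrow> (u, i) \<notin> B"
    "\<And>i. i \<in> {..<m} - J1 \<Longrightarrow> \<exists>d\<in>{..<n} - (A1 \<union> U1). (d, i) \<in> B"
    "\<And>x y. x \<in> A1 \<Longrightarrow> y \<in> A1 \<Longrightarrow> (x, y) \<in> (shared {..<n} {..<m} B)\<^sup>*"
    using Suc.IH[OF _ s] Suc.prems(1) by auto
  let ?E = "shared {..<n} {..<m} B"
  let ?v = "next_vertex A1 U1"
  let ?I = "{i \<in> J1. (?v, i) \<in> B}"
  let ?N = "nbrs (U1 - {?v}) ?I B"
  have st: "step B (A1, U1, J1) = (A, U, J)"
    using Suc.prems(2) s unfolding explore_Suc_step by simp
  then have eq: "A = A1 - {?v} \<union> ?N" "U = U1 - {?v} - ?N" "J = J1 - ?I"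
    by (auto simp: step_def process_def Let_def)
  have fin: "finite A1" "finite U1" using finite_subset[OF IH(1)] finite_subset[OF IH(2)] by auto
  have ne: "A1 \<union> U1 \<noteq> {}" using IH(5) Suc.prems(1) by auto
  note sf = step_fresh[OF fin ne IH(3) st]
  have v: "?v \<in> A1 \<union> U1" "A1 \<noteq> {} \<Longrightarrow> ?v \<in> A1" using next_vertex_in[OF fin ne] by auto
  have vn: "?v < n" using v(1) IH(1,2) by auto
  have AU: "{..<n} - (A \<union> U) = insert ?v ({..<n} - (A1 \<union> U1))" "?v \<notin> A \<union> U"
    unfolding sf(7) using vn v(1) by auto
  have nb: "(?v, x) \<in> ?E" if "x \<in> ?N" for x
    using that IH(2,4) vn by (auto simp: nbrs_def shared_def)
  have conn: "(?v, x) \<in> ?E\<^sup>*" if "x \<in> A" for x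
    using that nb[of x] IH(9)[OF v(2), of x] unfolding eq by auto
  show ?case
  proof (intro conjI ballI)
    show "A \<subseteq> {..<n}" "U \<subseteq> {..<n} - {v}" "A \<inter> U = {}" "J \<subseteq> {..<m}"
      using sf eq IH(1,2,4) by (auto simp: nbrs_def)
    show "card (A \<union> U) = n - Suc k" using sf(4) IH(5) by simp
    show "(d, i) \<notin> B" if "d \<in> {..<n} - (A \<union> U)" "i \<in> J" for d i
      using that IH(6) unfolding AU(1) eq(3) by auto
    show "(u, i) \<notin> B" if "i \<in> {..<m} - J" "u \<in> U" for u i
      using that IH(7) unfolding eq(2,3) by (auto simp: nbrs_def)
    show "\<exists>d\<in>{..<n} - (A \<union> U). (d, i) \<in> B" if "i \<in> {..<m} - J" for i
      using that IH(8)[of i] unfolding AU(1) eq(3) by auto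
    show "(x, y) \<in> ?E\<^sup>*" if "x \<in> A" "y \<in> A" for x y
      using shared_rtrancl_sym[OF conn[OF that(1)]] conn[OF that(2)] by (rule rtrancl_trans)
  qed
qed

text \<open>Without a restart every vertex is discovered as a neighbour of an active one, so by
  induction all discovered vertices lie in the component of \<open>v\<close>.\<close>

lemma explore_alive:
  assumes "v < n" "k \<le> n" "\<And>j. j < k \<Longrightarrow> fst (explore j B (start n m v)) \<noteq> {}"
    "explore k B (start n m v) = (A, U, J)" "x < n" "x \<notin> U"
  shows "(v, x) \<in> (shared {..<n} {..<m} B)\<^sup>*"
  using assms(2-)
proof (induction k arbitrary: A U J x)
  case 0
  then show ?case by auto
next
  case (Suc k)
  obtain A1 U1 J1 where s: "explore k B (start n m v) = (A1, U1, J1)" by (metis surj_pair)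
  let ?E = "shared {..<n} {..<m} B"
  let ?v = "next_vertex A1 U1"
  let ?I = "{i \<in> J1. (?v, i) \<in> B}"
  have inv: "A1 \<subseteq> {..<n}" "U1 \<subseteq> {..<n}" "J1 \<subseteq> {..<m}" "A1 \<inter> U1 = {}"
    using explore_invariant[OF assms(1) _ s] Suc.prems(1) by auto
  have "step B (A1, U1, J1) = (A, U, J)"
    using Suc.prems(3) s unfolding explore_Suc_step by simp
  then have U: "U = U1 - {?v} - nbrs (U1 - {?v}) ?I B"
    by (auto simp: step_def process_def Let_def)
  have "A1 \<noteq> {}" using Suc.prems(2)[of k] s by simp
  then have v: "?v \<in> A1"
    using inv by (intro next_vertex_in(2)) (auto intro: finite_subset[of _ "{..<n}"])
  have IH: "(v, y) \<in> ?E\<^sup>*" if "y < n" "y \<notin> U1" for y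
    using Suc.prems(1,2) s that by (intro Suc.IH[of A1 U1 J1]) auto
  have vv: "(v, ?v) \<in> ?E\<^sup>*" using v inv by (intro IH) auto
  show ?case
  proof (cases "x \<in> U1")
    case True
    then have "x \<in> nbrs (U1 - {?v}) ?I B" using Suc.prems(5) U v inv by auto
    then have "(?v, x) \<in> ?E" using v inv by (auto simp: nbrs_def shared_def)
    with vv show ?thesis by (rule rtrancl_into_rtrancl)
  qed (use IH Suc.prems in auto)
qed

text \<open>With no active vertex the discovered vertices are exactly the \<open>k\<close> processed
  ones. They own only used attributes, and undiscovered vertices own none of these, so the set is
  closed under adjacency and contains the component of \<open>v\<close>. Earlier restarts do no
  harm.\<close>

lemma explore_exhausted:
  assumes "v < n" "k \<le> n" "explore k B (start n m v) = ({}, U, J)"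
  shows "card ((shared {..<n} {..<m} B)\<^sup>* `` {v}) \<le> k"
proof -
  note inv = explore_invariant[OF assms]
  have U: "U \<subseteq> {..<n}" "card U = n - k" using inv by auto
  have cl: "x \<in> {..<n} - U" if "(v, x) \<in> (shared {..<n} {..<m} B)\<^sup>*" for x
    using that
  proof (induction rule: rtrancl_induct)
    case base
    then show ?case using inv assms(1) by auto
  next
    case (step y z)
    then obtain i where i: "i < m" "(y, i) \<in> B" "(z, i) \<in> B" "z < n" by (auto simp: shared_def)
    have "i \<notin> J" using inv step.IH i by auto
    then show ?case using inv i by auto
  qed
  have "card ((shared {..<n} {..<m} B)\<^sup>* `` {v}) \<le> card ({..<n} - U)"
    using cl by (intro card_mono) auto
  also have "\<dots> = n - (n - k)" using U by (simp add: card_Diff_subset finite_subset)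
  finally show ?thesis using assms(2) by simp
qed

section \<open>Two distinct large components are unlikely\<close>

context random_bipartite
begin

text \<open>
  The exploration has stopped with the active set \<open>A\<close>, and \<open>w\<close> lies in a large component that avoids it.
  This component lives on the rows of \<open>U\<close>, which are independent of the rows of \<open>A\<close>.
\<close>

definition missed :: "real \<Rightarrow> real \<Rightarrow> nat \<Rightarrow> exploration \<Rightarrow> (nat \<times> nat) set \<Rightarrow> bool" where
  "missed h x w = (\<lambda>(A, U, J) B. h \<le> card A \<and> x \<le> (\<Sum>i\<in>touched U J B w. p i) \<and>
     (\<forall>u\<in>A. \<forall>i\<in>touched U J B w. (u, i) \<notin> B))"

lemma expect_avoid:
  assumes "finite A" "finite J" "T \<subseteq> J"
  shows "expect A J (\<lambda>B. of_bool (\<forall>u\<in>A. \<forall>i\<in>T. (u, i) \<notin> B)) = (\<Prod>i\<in>T. 1 - p i) ^ card A"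
proof -
  have "expect A J (\<lambda>B. of_bool (\<forall>u\<in>A. \<forall>i\<in>T. (u, i) \<notin> B)) =
     expect A J (\<lambda>B. \<Prod>x\<in>A \<times> J. if x \<in> B then of_bool (snd x \<notin> T) else 1)"
  proof (intro bexp_cong refl)
    fix B assume "B \<subseteq> A \<times> J"
    show "of_bool (\<forall>u\<in>A. \<forall>i\<in>T. (u, i) \<notin> B) = (\<Prod>x\<in>A \<times> J. if x \<in> B then of_bool (snd x \<notin> T) else 1 :: real)"
    proof (cases "\<forall>u\<in>A. \<forall>i\<in>T. (u, i) \<notin> B")
      case True
      then have "(\<Prod>x\<in>A \<times> J. if x \<in> B then of_bool (snd x \<notin> T) else 1 :: real) = 1"
        by (intro prod.neutral) auto
      with True show ?thesis by (simp only: of_bool_eq if_True) simp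
    next
      case False
      then obtain u i where "u \<in> A" "i \<in> T" "(u, i) \<in> B" by auto
      then have "(\<Prod>x\<in>A \<times> J. if x \<in> B then of_bool (snd x \<notin> T) else 1 :: real) = 0"
        using assms by (intro prod_zero bexI[of _ "(u, i)"]) auto
      then show ?thesis using False by auto
    qed
  qed
  also have "\<dots> = (\<Prod>x\<in>A \<times> J. if snd x \<in> T then 1 - p (snd x) else 1)"
    using assms by (subst bexp_prod) (auto intro!: prod.cong)
  also have "\<dots> = (\<Prod>u\<in>A. \<Prod>i\<in>J. if i \<in> T then 1 - p i else 1)"
    unfolding prod.cartesian_product by (intro prod.cong) auto
  also have "(\<Prod>i\<in>J. if i \<in> T then 1 - p i else 1) = (\<Prod>i\<in>T. 1 - p i)"
    using assms by (simp add: prod.If_cases Int_absorb1)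
  finally show ?thesis by simp
qed

text \<open>Given the rows of \<open>U\<close>, the set \<open>touched U J B w\<close> is fixed
  while the rows of \<open>A\<close> are still random. Each vertex of \<open>A\<close> avoids a set
  of mass \<open>x\<close> with probability at most \<open>exp (- x)\<close>, independently of the
  others.\<close>

lemma missed_prob:
  assumes fin: "finite A" "finite U" "finite J" "A \<inter> U = {}" and x: "0 \<le> x"
  shows "expect (A \<union> U) J (\<lambda>B. of_bool (missed h x w (A, U, J) B)) \<le> exp (- (h * x))"
proof -
  have loc: "touched U J (X \<union> Y) w = touched U J X w" if "Y \<subseteq> A \<times> J" for X Y
  proof -
    have "shared U J (X \<union> Y) = shared U J X" using that fin(4) by (auto simp: shared_def)
    then show ?thesis using that fin(4) by (auto simp: touched_def)
  qed
  have "expect (A \<union> U) J (\<lambda>B. of_bool (missed h x w (A, U, J) B)) =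
     expect U J (\<lambda>X. expect A J (\<lambda>Y. of_bool (missed h x w (A, U, J) (X \<union> Y))))"
    using expect_Un[of U A J] fin by (simp add: Un_commute Int_commute)
  also have "\<dots> \<le> expect U J (\<lambda>X. exp (- (h * x)))"
  proof (rule expect_mono)
    fix X assume X: "X \<subseteq> U \<times> J"
    let ?T = "touched U J X w"
    have TJ: "?T \<subseteq> J" by (auto simp: touched_def)
    show "expect A J (\<lambda>Y. of_bool (missed h x w (A, U, J) (X \<union> Y))) \<le> exp (- (h * x))"
    proof (cases "h \<le> card A \<and> x \<le> (\<Sum>i\<in>?T. p i)")
      case True
      have "expect A J (\<lambda>Y. of_bool (missed h x w (A, U, J) (X \<union> Y))) \<le>
          expect A J (\<lambda>Y. of_bool (\<forall>u\<in>A. \<forall>i\<in>?T. (u, i) \<notin> Y))"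
        by (rule expect_mono) (auto simp: missed_def loc)
      also have "\<dots> = (\<Prod>i\<in>?T. 1 - p i) ^ card A" using fin TJ by (intro expect_avoid)
      also have "\<dots> \<le> exp (- x) ^ card A"
      proof (intro power_mono)
        have "(\<Prod>i\<in>?T. 1 - p i) \<le> exp (- (\<Sum>i\<in>?T. p i))" by (rule prod_le_exp_sum)
        also have "\<dots> \<le> exp (- x)" using True by simp
        finally show "(\<Prod>i\<in>?T. 1 - p i) \<le> exp (- x)" .
      qed (use p_le_1 in \<open>auto intro: prod_nonneg\<close>)
      also have "\<dots> = exp (- (card A * x))" by (simp add: exp_of_nat_mult[symmetric])
      also have "\<dots> \<le> exp (- (h * x))"
        unfolding exp_le_cancel_iff neg_le_iff_le using True x by (intro mult_right_mono) auto
      finally show ?thesis .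
    next
      case False
      have "expect A J (\<lambda>Y. of_bool (missed h x w (A, U, J) (X \<union> Y))) \<le> expect A J (\<lambda>Y. 0)"
        using False by (intro expect_mono) (auto simp: missed_def loc)
      then show ?thesis using fin bexp_const[of "A \<times> J" _ 0] by (simp add: order_trans[OF _ exp_ge_zero])
    qed
  qed
  also have "\<dots> = exp (- (h * x))" using fin by (intro bexp_const) auto
  finally show ?thesis .
qed

text \<open>The event reads only fresh pairs, so \<open>explore_markov\<close> transfers the bound
  of \<open>missed_prob\<close> to the state after \<open>k\<close> steps.\<close>

lemma explore_missed_prob:
  assumes "v < n" "k \<le> n" "0 \<le> x"
  shows "expect {..<n} {..<m} (\<lambda>B. of_bool (missed h x w (explore k B (start n m v)) B)) \<le> exp (- (h * x))"
proof -
  have vn: "{v} \<union> ({..<n} - {v}) = {..<n}" using assms by auto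
  have "expect ({v} \<union> ({..<n} - {v})) {..<m}
     (\<lambda>B. of_bool (missed h x w (explore k B (start n m v)) B)) \<le> exp (- (h * x))"
  proof (rule explore_markov)
    show "k \<le> card ({v} \<union> ({..<n} - {v}))" unfolding vn using assms by simp
    show "of_bool (missed h x w (A, U, J) (B \<inter> fresh (A, U, J))) = of_bool (missed h x w (A, U, J) B)"
      for A U J B
    proof -
      have "shared U J (B \<inter> fresh (A, U, J)) = shared U J B" by (auto simp: shared_def fresh_def)
      then have "touched U J (B \<inter> fresh (A, U, J)) w = touched U J B w"
        by (auto simp: touched_def fresh_def)
      moreover have "touched U J B w \<subseteq> J" by (auto simp: touched_def)
      ultimately show ?thesis by (auto simp: missed_def fresh_def)
    qed
  qed (use assms missed_prob in auto)
  then show ?thesis unfolding vn .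
qed

text \<open>The deterministic part: under \<open>typc\<close> and \<open>hit\<close>, the
  exploration of a component with more than \<open>k1\<close> vertices stays alive through step
  \<open>k2\<close>, any two such components coincide, and one exists.\<close>

lemma giant_component_shared:
  fixes n m k1 k2 :: nat and a b :: real
  assumes n: "0 < n" and k: "1 \<le> k1" "k1 \<le> k2" "k2 \<le> n" and b: "1 < b" "k1 < (b - 1) * k2"
    and typc: "\<And>v k. v < n \<Longrightarrow> k1 \<le> k \<Longrightarrow> k \<le> k2 \<Longrightarrow> typical n m a b k (explore k B (start n m v))"
    and hit: "\<And>v w. v < n \<Longrightarrow> w < n \<Longrightarrow>
       \<not> missed ((b - 1) * k2) (a * k2 / n) w (explore k2 B (start n m v)) B"
  shows "giant_component {..<n} (shared {..<n} {..<m} B) ((b - 1) * k2) k1"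
proof -
  let ?E = "shared {..<n} {..<m} B"
  let ?C = "\<lambda>v. ?E\<^sup>* `` {v}"
  have card_A: "(b - 1) * j \<le> card A" if "v < n" "k1 \<le> j" "j \<le> k2" "explore j B (start n m v) = (A, U, J)" for v j A U J
  proof -
    have "typical n m a b j (A, U, J)" using typc[OF that(1-3)] that(4) by simp
    then have U: "real (card U) \<le> real n - b * real j" by (simp add: typical_def)
    have inv: "A \<subseteq> {..<n}" "U \<subseteq> {..<n}" "A \<inter> U = {}" "card (A \<union> U) = n - j"
      using explore_invariant[OF that(1) _ that(4)] that k by auto
    have "card A + card U = n - j"
      using inv finite_subset by (subst inv(4)[symmetric], subst card_Un_disjoint) auto
    then have "real (card A) + card U = real n - j" using that k by linarith
    then show ?thesis using U by (simp add: algebra_simps)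
  qed
  \<comment> \<open>Up to step \<open>k1\<close> an empty active set would bound the component by
    \<open>j\<close>; after that typicality leaves at least \<open>(b - 1) * j > 0\<close> active
    vertices.\<close>
  have alive: "fst (explore j B (start n m v)) \<noteq> {}" if "v < n" "k1 < card (?C v)" "j \<le> k2" for v j
  proof
    assume "fst (explore j B (start n m v)) = {}"
    then obtain U J where e: "explore j B (start n m v) = ({}, U, J)" by (metis fst_conv surj_pair)
    show False
    proof (cases "j \<le> k1")
      case True
      then show False using explore_exhausted[OF that(1) _ e] that k by auto
    next
      case False
      then have "0 < (b - 1) * j" using b by auto
      then show False using card_A[OF that(1) _ that(3) e] False by simp
    qed
  qed
  have reach: "(v, x) \<in> ?E\<^sup>*" if "v < n" "k1 < card (?C v)" "explore k2 B (start n m v) = (A, U, J)"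
     "x < n" "x \<notin> U" for v A U J x
    using that k by (intro explore_alive[OF that(1) _ _ that(3)] alive) auto
  have large_eq: "(v, w) \<in> ?E\<^sup>*" if vw: "v < n" "w < n" "k1 < card (?C v)" "k1 < card (?C w)" for v w
  proof (rule ccontr)
    assume non: "(v, w) \<notin> ?E\<^sup>*"
    obtain A U J where s: "explore k2 B (start n m v) = (A, U, J)" by (metis surj_pair)
    obtain A' U' J' where s': "explore k2 B (start n m w) = (A', U', J')" by (metis surj_pair)
    note inv = explore_invariant[OF vw(1) k(3) s] and inv' = explore_invariant[OF vw(2) k(3) s']
    have subE: "shared U J B \<subseteq> ?E" using inv by (intro shared_mono) auto
    \<comment> \<open>Vertices outside \<open>U\<close> belong to the component of \<open>v\<close>,
      so the whole component of \<open>w\<close> is undiscovered and can be traced inside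
      \<open>shared U J B\<close>.\<close>
    have CU: "x \<in> U" if "(w, x) \<in> ?E\<^sup>*" for x
    proof (rule ccontr)
      assume "x \<notin> U"
      moreover have "x < n" using that vw(2) by (cases rule: rtranclE) (auto simp: shared_def)
      ultimately have "(v, x) \<in> ?E\<^sup>*" using reach[OF vw(1,3) s] by auto
      then show False using shared_rtrancl_sym[OF that] non by (meson rtrancl_trans)
    qed
    have CJ: "i \<in> J" if "(w, x) \<in> ?E\<^sup>*" "i < m" "(x, i) \<in> B" for x i
      using inv CU[OF that(1)] that by blast
    have CH: "(w, x) \<in> (shared U J B)\<^sup>*" if "(w, x) \<in> ?E\<^sup>*" for x
      using that
    proof (induction rule: rtrancl_induct)
      case (step y z)
      have wz: "(w, z) \<in> ?E\<^sup>*" using step by (meson rtrancl.rtrancl_into_rtrancl)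
      obtain i where i: "i < m" "(y, i) \<in> B" "(z, i) \<in> B" "y \<noteq> z"
        using step.hyps(2) by (auto simp: shared_def)
      have "(y, z) \<in> shared U J B"
        using CU[OF step.hyps(1)] CU[OF wz] CJ[OF wz i(1,3)] i by (auto simp: shared_def)
      with step.IH show ?case by (rule rtrancl_into_rtrancl)
    qed simp
    \<comment> \<open>An attribute used by the exploration from \<open>w\<close> has a processed
      owner, which lies in the component of \<open>w\<close>; typicality of that exploration then
      gives the mass.\<close>
    have used: "{..<m} - J' \<subseteq> touched U J B w"
    proof
      fix i assume i: "i \<in> {..<m} - J'"
      then obtain d where d: "d \<in> {..<n} - (A' \<union> U')" "(d, i) \<in> B" using inv' by blast
      have wd: "(w, d) \<in> ?E\<^sup>*" using reach[OF vw(2,4) s'] d by auto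
      then show "i \<in> touched U J B w"
        using CU[OF wd] CH[OF wd] CJ[OF wd _ d(2)] i d by (auto simp: touched_def)
    qed
    have "a * k2 / n \<le> (\<Sum>i\<in>{..<m} - J'. p i)"
      using typc[OF vw(2) k(2)] s' by (simp add: typical_def)
    also have "\<dots> \<le> (\<Sum>i\<in>touched U J B w. p i)"
      using used p_nonneg inv by (intro sum_mono2) (auto simp: touched_def intro: finite_subset[of _ "{..<m}"])
    finally have mass: "a * k2 / n \<le> (\<Sum>i\<in>touched U J B w. p i)" .
    have "(u, i) \<notin> B" if u: "u \<in> A" and i: "i \<in> touched U J B w" for u i
    proof
      assume ui: "(u, i) \<in> B"
      obtain x where x: "x \<in> U" "(w, x) \<in> (shared U J B)\<^sup>*" "(x, i) \<in> B" "i \<in> J"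
        using i by (auto simp: touched_def)
      have wx: "(w, x) \<in> ?E\<^sup>*" using x(2) rtrancl_mono[OF subE] by auto
      have "(x, u) \<in> ?E" using x ui u inv by (auto simp: shared_def)
      with wx have "(w, u) \<in> ?E\<^sup>*" by (rule rtrancl_into_rtrancl)
      then have "u \<in> U" by (rule CU)
      then show False using u inv by auto
    qed
    moreover have "(b - 1) * k2 \<le> card A" using card_A[OF vw(1) k(2) _ s] by simp
    ultimately show False using hit[OF vw(1,2)] mass s by (auto simp: missed_def)
  qed
  \<comment> \<open>Existence: whatever restarts occurred, the active vertices at step
    \<open>k2\<close> lie in one component, and there are more than \<open>k1\<close> of
    them.\<close>
  obtain A U J where s: "explore k2 B (start n m 0) = (A, U, J)" by (metis surj_pair)
  note inv = explore_invariant[OF n k(3) s]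
  have cA: "(b - 1) * k2 \<le> card A" using card_A[OF n k(2) _ s] by simp
  then have "0 < card A" using b by linarith
  then obtain w where w: "w \<in> A" by fastforce
  then have wn: "w < n" using inv by auto
  have C_sub: "?C v \<subseteq> {..<n}" if "v < n" for v
  proof
    fix x assume "x \<in> ?C v"
    then have "(v, x) \<in> ?E\<^sup>*" by simp
    then show "x \<in> {..<n}" using that by (cases rule: rtranclE) (auto simp: shared_def)
  qed
  have "card A \<le> card (?C w)"
    using inv w C_sub[OF wn] by (intro card_mono finite_subset[OF C_sub[OF wn]]) auto
  then have cC: "(b - 1) * k2 \<le> card (?C w)" using cA by linarith
  then have k1C: "k1 < card (?C w)" using b by linarith
  have others: "card C' \<le> k1" if C': "C' \<in> components {..<n} ?E" "C' \<noteq> ?C w" for C'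
  proof (rule ccontr)
    assume "\<not> card C' \<le> k1"
    obtain v where v: "v < n" "C' = ?C v" using C' by (auto simp: components_def quotient_def)
    then have vw: "(w, v) \<in> ?E\<^sup>*" using \<open>\<not> card C' \<le> k1\<close> k1C wn by (intro large_eq) auto
    have "?C v = ?C w"
      using vw shared_rtrancl_sym[OF vw] by (auto intro: rtrancl_trans)
    then show False using C'(2) v(2) by simp
  qed
  show ?thesis
    unfolding giant_component_def unique_largest_component_def
  proof (intro exI[of _ "?C w"] conjI ballI impI)
    show "?C w \<in> components {..<n} ?E" using wn by (auto simp: components_def quotient_def)
    show "(b - 1) * k2 \<le> card (?C w)" by (rule cC)
    show "card C' < card (?C w)" "real (card C') \<le> k1" if "C' \<in> components {..<n} ?E" "C' \<noteq> ?C w" for C'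
      using others[OF that] k1C by auto
  qed
qed

end

section \<open>Asymptotics\<close>

text \<open>Union bound over starting vertices and steps for atypical states, and over pairs of
  vertices for missed components.\<close>

lemma (in random_bipartite) giant_prob:
  fixes n m k1 k2 :: nat and s a b c d t \<eta> :: real
  assumes n: "0 < n" and k: "1 \<le> k1" "k1 \<le> k2" "k2 \<le> d * s" and b: "1 < b" "k1 < (b - 1) * k2"
    and s: "0 < s" "s \<le> n" "\<And>i. i < m \<Longrightarrow> p i * s \<le> 1"
    and sum: "real n * (\<Sum>i<m. (p i)\<^sup>2) = c"
    and t: "0 \<le> t" "t \<le> 1" and d: "0 \<le> d" "d \<le> 1" "a * d \<le> 1" and a: "0 \<le> a"
    and C1: "a + \<eta> \<le> c * (1 - d / 2) * (1 - t / 2)"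
    and C2: "b + \<eta> \<le> (1 - t / 2) * a * (1 - a * d / 2)" and \<eta>: "0 \<le> \<eta>"
  shows "1 - (real n)\<^sup>2 * (2 * exp (- (t * \<eta> * k1 * s / n)) + exp (- ((b - 1) * k2 * (a * k2 / n)))) \<le>
     measure_pmf.prob (bipartite_pmf n m p)
       {B. giant_component {..<n} (intersection_edges n m B) ((b - 1) * k2) k1}"
proof -
  let ?G = "\<lambda>B. giant_component {..<n} (shared {..<n} {..<m} B) ((b - 1) * k2) k1"
  let ?S = "{..<n} \<times> {..<m}"
  let ?x = "a * k2 / n" and ?h = "(b - 1) * k2"
  let ?N = "\<lambda>v k B. of_bool (\<not> typical n m a b k (explore k B (start n m v))) :: real"
  let ?M = "\<lambda>v w B. of_bool (missed ?h ?x w (explore k2 B (start n m v)) B) :: real"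
  let ?e1 = "exp (- (t * \<eta> * k1 * s / n))" and ?e2 = "exp (- (?h * ?x))"
  have "d * s \<le> 1 * real n" using d s by (intro mult_mono) auto
  then have k2n: "k2 \<le> n" using k by simp
  have "expect {..<n} {..<m} (\<lambda>B. of_bool (\<not> ?G B)) \<le>
     expect {..<n} {..<m} (\<lambda>B. 1 * (\<Sum>v<n. \<Sum>k=k1..k2. ?N v k B) + 1 * (\<Sum>v<n. \<Sum>w<n. ?M v w B))"
  proof (rule expect_mono)
    fix B
    let ?L = "1 * (\<Sum>v<n. \<Sum>k=k1..k2. ?N v k B) + 1 * (\<Sum>v<n. \<Sum>w<n. ?M v w B)"
    have nn: "0 \<le> (\<Sum>v<n. \<Sum>k=k1..k2. ?N v k B)" "0 \<le> (\<Sum>v<n. \<Sum>w<n. ?M v w B)"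
      by (intro sum_nonneg; simp)+
    show "of_bool (\<not> ?G B) \<le> ?L"
    proof (cases "?G B")
      case True
      then show ?thesis using nn by simp
    next
      case False
      then consider v k where "v < n" "k1 \<le> k" "k \<le> k2" "\<not> typical n m a b k (explore k B (start n m v))"
        | v w where "v < n" "w < n" "missed ?h ?x w (explore k2 B (start n m v)) B"
        using giant_component_shared[of n k1 k2 b m a B] n k(1,2) k2n b by blast
      then show ?thesis
      proof cases
        case 1
        have "1 \<le> (\<Sum>k=k1..k2. ?N v k B)"
          using member_le_sum[of k "{k1..k2}" "\<lambda>k. ?N v k B"] 1 by simp
        also have "\<dots> \<le> (\<Sum>v<n. \<Sum>k=k1..k2. ?N v k B)"
          using member_le_sum[of v "{..<n}" "\<lambda>v. \<Sum>k=k1..k2. ?N v k B"] 1 by (simp add: sum_nonneg)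
        finally show ?thesis using False nn by simp
      next
        case 2
        have "1 \<le> (\<Sum>w<n. ?M v w B)"
          using member_le_sum[of w "{..<n}" "\<lambda>w. ?M v w B"] 2 by simp
        also have "\<dots> \<le> (\<Sum>v<n. \<Sum>w<n. ?M v w B)"
          using member_le_sum[of v "{..<n}" "\<lambda>v. \<Sum>w<n. ?M v w B"] 2 by (simp add: sum_nonneg)
        finally show ?thesis using False nn by simp
      qed
    qed
  qed
  also have "\<dots> = (\<Sum>v<n. \<Sum>k=k1..k2. expect {..<n} {..<m} (?N v k)) +
     (\<Sum>v<n. \<Sum>w<n. expect {..<n} {..<m} (?M v w))"
    unfolding bexp_linear bexp_sum by simp
  also have "\<dots> \<le> (\<Sum>v<n. \<Sum>k=k1..k2. 2 * ?e1) + (\<Sum>v<n. \<Sum>w<n. ?e2)"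
  proof (intro add_mono sum_mono)
    fix v k assume v: "v \<in> {..<n}" and kk: "k \<in> {k1..k2}"
    have "expect {..<n} {..<m} (?N v k) \<le> 2 * exp (- (t * \<eta> * k * s / n))"
      using v kk k assms by (intro explore_bad_prob[where d = d and c = c]) auto
    also have "\<dots> \<le> 2 * ?e1"
      using kk t \<eta> s n by (auto intro!: divide_right_mono mult_right_mono mult_left_mono mult_nonneg_nonneg)
    finally show "expect {..<n} {..<m} (?N v k) \<le> 2 * ?e1" .
  next
    fix v w assume "v \<in> {..<n}" "w \<in> {..<n}"
    then show "expect {..<n} {..<m} (?M v w) \<le> ?e2"
      using k2n a by (intro explore_missed_prob) auto
  qed
  also have "\<dots> \<le> (real n)\<^sup>2 * (2 * ?e1 + ?e2)"
  proof -
    \<comment> \<open>As \<open>k1 \<ge> 1\<close>, there are at most \<open>k2 \<le> n\<close>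
      values of \<open>k\<close>, so both double sums have at most \<open>n ^ 2\<close>
      terms.\<close>
    have "real (Suc k2 - k1) \<le> n" using k k2n by simp
    then have "(real n * real (Suc k2 - k1)) * (2 * ?e1) \<le> (real n * n) * (2 * ?e1)"
      by (intro mult_right_mono mult_left_mono) auto
    then show ?thesis by (simp add: power2_eq_square algebra_simps)
  qed
  finally have bad: "expect {..<n} {..<m} (\<lambda>B. of_bool (\<not> ?G B)) \<le> (real n)\<^sup>2 * (2 * ?e1 + ?e2)" .
  have "bipartite_pmf n m p = Pi_pmf ?S False (\<lambda>x. bernoulli_pmf ((\<lambda>(v, i). p i) x))"
    unfolding bipartite_pmf_def by (intro Pi_pmf_cong) auto
  then have "measure_pmf.prob (bipartite_pmf n m p)
       {B. giant_component {..<n} (intersection_edges n m B) ((b - 1) * k2) k1} =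
     measure_pmf.prob (Pi_pmf ?S False (\<lambda>x. bernoulli_pmf ((\<lambda>(v, i). p i) x))) {B. ?G {x. B x}}"
    by (simp only: intersection_edges_shared)
  also have "\<dots> = expect {..<n} {..<m} (\<lambda>B. of_bool (?G B))"
    using p_nonneg p_le_1 by (intro prob_Pi_pmf_bernoulli) auto
  also have "\<dots> = expect {..<n} {..<m} (\<lambda>B. 1 * 1 + (- 1) * of_bool (\<not> ?G B))"
    by (intro bexp_cong) auto
  also have "\<dots> = 1 - expect {..<n} {..<m} (\<lambda>B. of_bool (\<not> ?G B))"
    unfolding bexp_linear by (simp add: bexp_const)
  finally show ?thesis using bad by simp
qed

lemma giant_component_mono:
  "giant_component V E s r \<Longrightarrow> s' \<le> s \<Longrightarrow> r \<le> r' \<Longrightarrow> giant_component V E s' r'"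
  unfolding giant_component_def by (meson order_trans)

text \<open>The factor \<open>C\<close> is absorbed by replacing \<open>\<delta>\<close> with
  \<open>\<delta> / C\<close>, and \<open>K\<close> stays. This yields both regimes from the version
  with \<open>min\<close>.\<close>

lemma whp_giant_of_order_mono:
  assumes "whp_giant_of_order m p s" "0 < C" "\<forall>\<^sub>F n in sequentially. s' n \<le> C * s n"
  shows "whp_giant_of_order m p s'"
proof -
  let ?r = "\<lambda>K n. K * max (real n * max_prob m p n * ln (real n)) (ln (real n))"
  let ?P = "\<lambda>f r n. measure_pmf.prob (bipartite_pmf n (m n) (p n))
       {B. giant_component {..<n} (intersection_edges n (m n) B) (f n) (r n)}"
  obtain \<delta> K where *: "0 < \<delta>" "0 < K" "?P (\<lambda>n. \<delta> * s n) (?r K) \<longlonglongrightarrow> 1"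
    using assms(1) unfolding whp_giant_of_order_def whp_intersection_graph_def by auto
  have "?P (\<lambda>n. \<delta> / C * s' n) (?r K) \<longlonglongrightarrow> 1"
  proof (rule tendsto_sandwich[OF _ _ *(3) tendsto_const])
    show "\<forall>\<^sub>F n in sequentially. ?P (\<lambda>n. \<delta> * s n) (?r K) n \<le> ?P (\<lambda>n. \<delta> / C * s' n) (?r K) n"
      using assms(3)
    proof eventually_elim
      case (elim n)
      then have "\<delta> / C * s' n \<le> \<delta> / C * (C * s n)"
        using * assms(2) by (intro mult_left_mono) auto
      then have "\<delta> / C * s' n \<le> \<delta> * s n" using assms(2) by simp
      then show ?case
        by (intro measure_pmf.finite_measure_mono) (auto intro: giant_component_mono)
    qed
  qed auto
  then show ?thesis
    unfolding whp_giant_of_order_def whp_intersection_graph_def using * assms(2)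
    by (intro exI[of _ "\<delta> / C"] exI[of _ K]) auto
qed

text \<open>Eventually the minimum is at least \<open>n powr \<gamma>\<close> or equal to
  \<open>n\<close>, and the squares of both beat \<open>n * ln n\<close>. This is the one place
  where \<open>\<gamma> > 1 / 2\<close> matters.\<close>

lemma eventually_scale_large:
  fixes P :: "nat \<Rightarrow> real"
  assumes "\<gamma> > 1 / 2" "P \<in> o(\<lambda>n. real n powr (- \<gamma>))" "\<forall>\<^sub>F n in sequentially. 0 < P n"
  shows "\<forall>\<^sub>F n in sequentially. M * (n * ln n) \<le> (min (1 / P n) n)\<^sup>2"
proof -
  define M' where "M' = max M 1"
  have "\<forall>\<^sub>F n in sequentially. norm (P n) \<le> 1 * norm (real n powr (- \<gamma>))"
    using landau_o.smallD[OF assms(2), of 1] by simp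
  moreover have "\<forall>\<^sub>F n in sequentially. ln (real n) / real n powr (2 * \<gamma> - 1) < 1 / M'"
    using order_tendstoD(2)[OF lim_ln_over_power[of "2 * \<gamma> - 1"], of "1 / M'"] assms(1)
    by (simp add: M'_def)
  moreover have "\<forall>\<^sub>F n in sequentially. ln (real n) / real n < 1 / M'"
    using order_tendstoD(2)[OF lim_ln_over_n, of "1 / M'"] by (simp add: M'_def)
  ultimately show ?thesis
    using assms(3) eventually_ge_at_top[of 1]
  proof eventually_elim
    case (elim n)
    have M': "0 < M'" "M \<le> M'" by (auto simp: M'_def)
    have "M * (n * ln n) \<le> M' * (n * ln n)" using M' elim by (intro mult_right_mono) auto
    also have "\<dots> \<le> (min (1 / P n) n)\<^sup>2"
    proof (cases "1 / P n \<le> n")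
      case True
      have "P n \<le> 1 / real n powr \<gamma>" using elim by (simp add: powr_minus_divide)
      then have g: "real n powr \<gamma> \<le> 1 / P n" using elim by (simp add: field_simps)
      have "M' * ln n \<le> real n powr (2 * \<gamma> - 1)" using elim M' by (simp add: field_simps)
      then have "real n * (M' * ln n) \<le> real n * real n powr (2 * \<gamma> - 1)" by (intro mult_left_mono) auto
      also have "\<dots> = real n powr (1 + (2 * \<gamma> - 1))" unfolding powr_add using elim by simp
      also have "\<dots> = (real n powr \<gamma>)\<^sup>2" using elim by (simp add: powr_power mult.commute)
      also have "\<dots> \<le> (1 / P n)\<^sup>2" using g by (intro power_mono) auto
      finally show ?thesis using True by (simp add: mult_ac)
    next
      case False
      have "M' * ln n \<le> n" using elim M' by (simp add: field_simps)
      then have "real n * (M' * ln n) \<le> real n * n" by (intro mult_left_mono) auto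
      then show ?thesis using False by (simp add: power2_eq_square mult_ac)
    qed
    finally show ?case .
  qed
qed

text \<open>The single scale \<open>s\<close> treats both regimes at once; \<open>giant_prob\<close>
  is applied with \<open>k1\<close> of order \<open>ln n * n / s\<close> and \<open>k2\<close> of
  order \<open>s\<close>.\<close>

lemma whp_giant_min:
  fixes m :: "nat \<Rightarrow> nat" and p :: "nat \<Rightarrow> nat \<Rightarrow> real" and c \<gamma> :: real
  assumes p: "\<And>n i. n \<ge> 1 \<Longrightarrow> i < m n \<Longrightarrow> 0 \<le> p n i \<and> p n i \<le> 1"
    and c: "c > 1"
    and sum: "\<And>n. n \<ge> 1 \<Longrightarrow> real n * (\<Sum>i<m n. (p n i)\<^sup>2) = c"
    and g: "\<gamma> > 1 / 2"
    and o: "max_prob m p \<in> o(\<lambda>n. real n powr (- \<gamma>))"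
    and pos: "\<And>n. n \<ge> 1 \<Longrightarrow> 0 < max_prob m p n"
    and le: "\<And>n i. i < m n \<Longrightarrow> p n i \<le> max_prob m p n"
  shows "whp_giant_of_order m p (\<lambda>n. min (1 / max_prob m p n) (real n))"
proof -
  define s where "s = (\<lambda>n. min (1 / max_prob m p n) (real n))"
  define L where "L = (\<lambda>n. max (real n * max_prob m p n * ln (real n)) (ln (real n)))"
  \<comment> \<open>The gaps in \<open>1 < b < a < c\<close> are all \<open>2 * \<eta>\<close>: one
    \<open>\<eta>\<close> is the slack kept in the exponents, the other pays for second-order
    losses.\<close>
  define \<eta> where "\<eta> = (c - 1) / 6"
  define a where "a = 1 + 4 * \<eta>"
  define b where "b = 1 + 2 * \<eta>"
  \<comment> \<open>\<open>d\<close> also serves as the tilt \<open>t\<close>; dividing by the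
    square of \<open>c\<close> bounds the losses \<open>c * d\<close> and \<open>a * (a * d)\<close>
    by \<open>\<eta>\<close>.\<close>
  define d where "d = \<eta> / c\<^sup>2"
  have \<eta>: "0 < \<eta>" and ca: "c = a + 2 * \<eta>" "a = b + 2 * \<eta>" "1 < b" "b < a" "a < c"
    using c by (auto simp: \<eta>_def a_def b_def field_simps)
  have d0: "0 < d" using \<eta> c by (simp add: d_def)
  have ccd: "c * c * d = \<eta>" using c by (simp add: d_def power2_eq_square)
  have "c * d * 1 \<le> c * d * c" using c d0 by (intro mult_left_mono) auto
  then have cd: "c * d \<le> \<eta>" using ccd by (simp add: mult_ac)
  have cd1: "c * d \<le> 1"
  proof -
    have "c * (c * d) = (c - 1) / 6" using ccd by (simp only: \<eta>_def mult.assoc)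
    also have "\<dots> \<le> c * 1" using c by simp
    finally have "c * (c * d) \<le> c * 1" .
    then show ?thesis by (rule mult_left_le_imp_le) (use c in simp)
  qed
  have ad: "a * d \<le> c * d" using ca d0 by (intro mult_right_mono) auto
  have ad1: "a * d \<le> 1" using ad cd1 by simp
  have "1 * d \<le> c * d" using c d0 by (intro mult_right_mono) auto
  then have d1: "d \<le> 1" using cd1 by simp
  have C1: "a + \<eta> \<le> c * (1 - d / 2) * (1 - d / 2)"
  proof -
    have "c * (1 - d) \<le> c * ((1 - d / 2) * (1 - d / 2))"
      using c by (intro mult_left_mono) (auto simp: algebra_simps)
    moreover have "a + \<eta> \<le> c * (1 - d)"
      unfolding right_diff_distrib using cd ca by simp
    ultimately show ?thesis by (simp only: mult.assoc)
  qed
  have C2: "b + \<eta> \<le> (1 - d / 2) * a * (1 - a * d / 2)"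
  proof -
    have "a * (a * d) \<le> c * (c * d)" using ca ad c d0 by (intro mult_mono) auto
    then have "a * (a * d) \<le> \<eta>" using ccd by simp
    moreover have "a * d \<le> \<eta>" using ad cd by simp
    moreover have "0 \<le> d * a * (a * d)" using d0 ca by simp
    moreover have "(1 - d / 2) * a * (1 - a * d / 2) = a - a * d / 2 - a * (a * d) / 2 + d * a * (a * d) / 4"
      by (simp add: field_simps)
    ultimately show ?thesis using ca(2) by linarith
  qed
  txt \<open>\<open>K\<close> and \<open>M\<close> make each of the two kinds of bad events have probability at most a multiple of \<open>n\<close> to the power \<open>- 3\<close>, which beats the \<open>n\<^sup>2\<close> of them.\<close>
  define K where "K = 3 / (d * \<eta>)"
  have K: "0 < K" using d0 \<eta> by (simp add: K_def)
  define M where "M = max (2 / d) (max (12 / ((b - 1) * a * d\<^sup>2)) (2 * (K + 1) / (min (b - 1) 1 * d) + 1))"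
  define k1 where "k1 = (\<lambda>n. nat \<lceil>K * L n\<rceil>)"
  define k2 where "k2 = (\<lambda>n. nat \<lfloor>d * s n\<rfloor>)"
  let ?P = "\<lambda>n. measure_pmf.prob (bipartite_pmf n (m n) (p n))
            {B. giant_component {..<n} (intersection_edges n (m n) B) ((b - 1) * d / 2 * s n) ((K + 1) * L n)}"
  have ev: "\<forall>\<^sub>F n in sequentially. 1 - 3 / real n \<le> ?P n"
  proof -
    have "\<forall>\<^sub>F n in sequentially. M * (n * ln n) \<le> (s n)\<^sup>2"
      unfolding s_def by (intro eventually_scale_large[OF g o] eventually_sequentiallyI[of 1] pos)
    then show ?thesis using eventually_ge_at_top[of 3]
    proof eventually_elim
      case (elim n)
      have n: "n \<ge> 1" "n \<ge> 3" using elim by auto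
      note pos = pos[OF n(1)]
      have s: "0 < s n" "s n \<le> n" using pos n by (auto simp: s_def)
      have "exp 1 \<le> real n" using exp_le n by linarith
      then have ln1: "1 \<le> ln (real n)" using n by (simp add: ln_ge_iff)
      have ns: "n / s n = max (n * max_prob m p n) 1"
        using pos n by (auto simp: s_def min_def max_def field_simps)
      \<comment> \<open>Thus \<open>L n\<close> is exactly the order \<open>ln n * n / s\<close>
        needed for \<open>k1\<close>, which becomes the bound on the small components.\<close>
      have L: "L n = ln n * (n / s n)"
        unfolding ns L_def using ln1 by (auto simp: max_def mult_le_cancel_left mult.commute)
      \<comment> \<open>The first three bounds give in turn \<open>2 \<le> d * s n\<close>, the
        exponent \<open>3 * ln n\<close> for missed components, and the strict inequality
        \<open>key\<close>.\<close>
      have M: "2 / d \<le> M" "12 / ((b - 1) * a * d\<^sup>2) \<le> M" "2 * (K + 1) / (min (b - 1) 1 * d) < M" "0 < M"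
        using d0 by (auto simp: M_def less_max_iff_disj)
      have Mb: "M * ln n \<le> (s n)\<^sup>2 / n" using elim n by (simp add: field_simps)
      also have "(s n)\<^sup>2 / n \<le> s n" using s n by (simp add: power2_eq_square field_simps)
      finally have "M * ln n \<le> s n" .
      moreover have "M * 1 \<le> M * ln n" using ln1 M by (intro mult_left_mono) auto
      ultimately have "2 / d \<le> s n" using M by linarith
      then have ds: "2 \<le> d * s n" using d0 by (simp add: field_simps)
      \<comment> \<open>Rounding down costs at most 1, which is at most half of
        \<open>d * s n\<close>.\<close>
      have k2: "real (k2 n) \<le> d * s n" "d * s n / 2 \<le> real (k2 n)"
        using ds unfolding k2_def by linarith+
      have "1 \<le> n / s n" using s n by simp
      then have "1 * 1 \<le> L n" unfolding L using ln1 by (intro mult_mono) auto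
      then have L1: "1 \<le> L n" by simp
      then have "0 < K * L n" using K by simp
      then have k1: "1 \<le> k1 n" "K * L n \<le> real (k1 n)" "real (k1 n) \<le> (K + 1) * L n"
        using L1 unfolding k1_def by (auto simp: algebra_simps) linarith+
      \<comment> \<open>The \<open>min\<close> yields \<open>k1 n \<le> k2 n\<close> and
        \<open>k1 n < (b - 1) * k2 n\<close> together.\<close>
      have key: "(K + 1) * L n < min (b - 1) 1 * (d * s n / 2)"
      proof -
        have b0: "0 < min (b - 1) 1 * d" using ca d0 by simp
        have "2 * (K + 1) < M * (min (b - 1) 1 * d)" using M(3) b0 by (simp add: pos_divide_less_eq)
        then have "2 * (K + 1) * ln n < M * (min (b - 1) 1 * d) * ln n" using ln1 by simp
        also have "\<dots> = min (b - 1) 1 * d * (M * ln n)" by simp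
        also have "\<dots> \<le> min (b - 1) 1 * d * ((s n)\<^sup>2 / n)" using Mb b0 by (intro mult_left_mono) auto
        finally have "2 * (K + 1) * ln n * (n / s n) < min (b - 1) 1 * d * ((s n)\<^sup>2 / n) * (n / s n)"
          using s n by (intro mult_strict_right_mono) auto
        also have "\<dots> = min (b - 1) 1 * d * s n" using s n by (simp add: power2_eq_square)
        also have "\<dots> = 2 * (min (b - 1) 1 * (d * s n / 2))" by simp
        finally have "2 * ((K + 1) * (ln n * (n / s n))) < 2 * (min (b - 1) 1 * (d * s n / 2))"
          by (simp only: mult.assoc)
        then show ?thesis unfolding L by (rule mult_left_less_imp_less) simp
      qed
      have "min (b - 1) 1 * (d * s n / 2) \<le> 1 * (d * s n / 2)"
        "min (b - 1) 1 * (d * s n / 2) \<le> (b - 1) * (d * s n / 2)"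
        using ds by (intro mult_right_mono; simp)+
      moreover have "(b - 1) * (d * s n / 2) \<le> (b - 1) * k2 n" using k2 ca by (intro mult_left_mono) auto
      ultimately have k12: "k1 n \<le> k2 n" "k1 n < (b - 1) * k2 n" "(b - 1) * d / 2 * s n \<le> (b - 1) * k2 n"
        using key k1 k2 by auto
      \<comment> \<open>The locale asks for probabilities at every index, so \<open>p n\<close> is
        extended by 0; only indices below \<open>m n\<close> enter the graph.\<close>
      define q where "q = (\<lambda>i. if i < m n then p n i else 0)"
      interpret random_bipartite q
        using p[OF n(1)] by unfold_locales (auto simp: q_def)
      have "bipartite_pmf n (m n) (p n) = bipartite_pmf n (m n) q"
        unfolding bipartite_pmf_def by (intro Pi_pmf_cong) (auto simp: q_def)
      moreover have "1 - (real n)\<^sup>2 * (2 * exp (- (d * \<eta> * k1 n * s n / n)) + exp (- ((b - 1) * k2 n * (a * k2 n / n)))) \<le>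
         measure_pmf.prob (bipartite_pmf n (m n) q)
         {B. giant_component {..<n} (intersection_edges n (m n) B) ((b - 1) * k2 n) (k1 n)}"
      proof (rule giant_prob[where c = c and d = d])
        fix i assume i: "i < m n"
        have "q i * s n \<le> max_prob m p n * (1 / max_prob m p n)"
          using i le[of i n] p[OF n(1) i] pos s by (intro mult_mono) (auto simp: q_def s_def)
        then show "q i * s n \<le> 1" using pos by simp
      next
        show "real n * (\<Sum>i<m n. (q i)\<^sup>2) = c" using sum[OF n(1)] by (simp add: q_def)
      qed (use n k1 k2 k12 ca(3,4) s d0 d1 ad1 C1 C2 \<eta> in auto)
      moreover have "\<dots> \<le> measure_pmf.prob (bipartite_pmf n (m n) q)
         {B. giant_component {..<n} (intersection_edges n (m n) B) ((b - 1) * d / 2 * s n) ((K + 1) * L n)}"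
        using k12(3) k1(3) by (intro measure_pmf.finite_measure_mono) (auto intro: giant_component_mono)
      moreover have "(real n)\<^sup>2 * (2 * exp (- (d * \<eta> * k1 n * s n / n)) + exp (- ((b - 1) * k2 n * (a * k2 n / n)))) \<le> 3 / n"
      proof -
        have en: "exp (- (3 * ln n)) = 1 / real n ^ 3"
          using n by (simp add: exp_minus exp_of_nat_mult[of 3, simplified] field_simps)
        have "3 * ln n = d * \<eta> * (K * L n) * (s n / n)"
          using s n d0 \<eta> by (simp add: K_def L)
        also have "\<dots> \<le> d * \<eta> * k1 n * (s n / n)"
          using k1 d0 \<eta> s by (intro mult_right_mono mult_left_mono) auto
        finally have e1: "exp (- (d * \<eta> * k1 n * s n / n)) \<le> 1 / real n ^ 3"
          unfolding en[symmetric] by simp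
        have ba: "0 < (b - 1) * a * d\<^sup>2" using ca d0 by simp
        have "12 \<le> (b - 1) * a * d\<^sup>2 * M" using M(2) ba by (simp add: pos_divide_le_eq mult.commute)
        then have "12 * ln n \<le> (b - 1) * a * d\<^sup>2 * M * ln n" using ln1 by (intro mult_right_mono) auto
        also have "\<dots> = (b - 1) * a * d\<^sup>2 * (M * ln n)" by simp
        also have "\<dots> \<le> (b - 1) * a * d\<^sup>2 * ((s n)\<^sup>2 / n)" using Mb ba by (intro mult_left_mono) auto
        also have "\<dots> = 4 * ((b - 1) * a * ((d * s n / 2)\<^sup>2 / n))"
          by (simp add: power_mult_distrib power_divide)
        finally have "3 * ln n \<le> (b - 1) * a * ((d * s n / 2)\<^sup>2 / n)"
          by linarith
        also have "\<dots> \<le> (b - 1) * a * ((real (k2 n))\<^sup>2 / n)"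
          using k2 ds ca by (intro mult_left_mono divide_right_mono power_mono) auto
        also have "\<dots> = (b - 1) * k2 n * (a * k2 n / n)" by (simp add: power2_eq_square)
        finally have e2: "exp (- ((b - 1) * k2 n * (a * k2 n / n))) \<le> 1 / real n ^ 3"
          unfolding en[symmetric] by simp
        have "(real n)\<^sup>2 * (2 * exp (- (d * \<eta> * k1 n * s n / n)) + exp (- ((b - 1) * k2 n * (a * k2 n / n)))) \<le>
           (real n)\<^sup>2 * (2 * (1 / real n ^ 3) + 1 / real n ^ 3)"
          using e1 e2 by (intro mult_left_mono add_mono) auto
        also have "\<dots> = 3 / n" using n by (simp add: power2_eq_square power3_eq_cube)
        finally show ?thesis .
      qed
      ultimately show ?case by simp
    qed
  qed
  have "(\<lambda>n. 1 - 3 / real n) \<longlonglongrightarrow> 1 - 0"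
    by (intro tendsto_diff tendsto_const lim_const_over_n)
  then have lim: "(\<lambda>n. 1 - 3 / real n) \<longlonglongrightarrow> 1" by simp
  have "?P \<longlonglongrightarrow> 1"
    by (rule tendsto_sandwich[OF ev _ lim tendsto_const]) auto
  moreover have "0 < (b - 1) * d / 2" "0 < K + 1" using ca(3) d0 K by auto
  ultimately show ?thesis
    unfolding whp_giant_of_order_def whp_intersection_graph_def s_def L_def by blast
qed

text \<open>The regimes \<open>o(n)\<close> and \<open>\<Omega>(n)\<close> for the inverse maximum
  do not exhaust all sequences. The statement with \<open>min\<close> covers every sequence and
  implies the other two by comparison of the sizes.\<close>

theorem theorem3:
  fixes m :: "nat \<Rightarrow> nat" and p :: "nat \<Rightarrow> nat \<Rightarrow> real" and c \<gamma> :: real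
  assumes "\<And>n i. n \<ge> 1 \<Longrightarrow> i < m n \<Longrightarrow> 0 \<le> p n i \<and> p n i \<le> 1"
    and "c > 1"
    and "\<And>n. n \<ge> 1 \<Longrightarrow> real n * (\<Sum>i<m n. (p n i)\<^sup>2) = c"
    and "\<gamma> > 1 / 2"
    and "max_prob m p \<in> o(\<lambda>n. real n powr (- \<gamma>))"
  shows "((\<lambda>n. 1 / max_prob m p n) \<in> o(\<lambda>n. real n) \<longrightarrow>
            whp_giant_of_order m p (\<lambda>n. 1 / max_prob m p n)) \<and>
         ((\<lambda>n. 1 / max_prob m p n) \<in> \<Omega>(\<lambda>n. real n) \<longrightarrow>
            whp_giant_of_order m p (\<lambda>n. real n)) \<and>
         whp_giant_of_order m p (\<lambda>n. min (1 / max_prob m p n) (real n))"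
proof -
  let ?P = "max_prob m p"
  have le: "p n i \<le> ?P n" if "i < m n" for n i
    unfolding max_prob_def using that by (intro Max_ge) auto
  \<comment> \<open>Otherwise all probabilities vanish, vacuously if \<open>m n = 0\<close>, and the
    sum of squares could not give \<open>c > 1\<close>.\<close>
  have pos: "0 < ?P n" if "n \<ge> 1" for n
  proof (rule ccontr)
    assume "\<not> 0 < ?P n"
    then have "p n i = 0" if "i < m n" for i
      using le[OF that] assms(1)[OF \<open>n \<ge> 1\<close> that] by linarith
    then show False using assms(2) assms(3)[OF that] by simp
  qed
  have main: "whp_giant_of_order m p (\<lambda>n. min (1 / ?P n) (real n))"
    by (rule whp_giant_min[OF assms pos le])
  have "whp_giant_of_order m p (\<lambda>n. 1 / ?P n)" if o: "(\<lambda>n. 1 / ?P n) \<in> o(\<lambda>n. real n)"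
  proof (rule whp_giant_of_order_mono[OF main, of 1])
    show "\<forall>\<^sub>F n in sequentially. 1 / ?P n \<le> 1 * min (1 / ?P n) (real n)"
      using landau_o.smallD[OF o zero_less_one]
    proof eventually_elim
      case (elim n)
      then have "1 / ?P n \<le> real n" using abs_ge_self[of "1 / ?P n"] by simp
      then show ?case by simp
    qed
  qed simp
  moreover have "whp_giant_of_order m p (\<lambda>n. real n)" if O: "(\<lambda>n. 1 / ?P n) \<in> \<Omega>(\<lambda>n. real n)"
  proof -
    obtain C where C: "C > 0" "\<forall>\<^sub>F n in sequentially. C * norm (real n) \<le> norm (1 / ?P n)"
      using landau_omega.bigE[OF O] by auto
    show ?thesis
    \<comment> \<open>\<open>1 / C\<close> serves the case where the minimum is
      \<open>1 / ?P n\<close>, and 1 the case where it is \<open>n\<close>.\<close>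
    proof (rule whp_giant_of_order_mono[OF main, of "max 1 (1 / C)"])
      show "\<forall>\<^sub>F n in sequentially. real n \<le> max 1 (1 / C) * min (1 / ?P n) (real n)"
        using C(2) eventually_ge_at_top[of 1]
      proof eventually_elim
        case (elim n)
        have P: "0 < 1 / ?P n" using pos[of n] elim by simp
        then have "C * n \<le> 1 / ?P n" using elim by simp
        then have "real n \<le> 1 / C * (1 / ?P n)" 
          using divide_right_mono[of "C * n" "1 / ?P n" C] C(1) by (simp add: mult.commute)
        also have "\<dots> \<le> max 1 (1 / C) * (1 / ?P n)" using P by (intro mult_right_mono) auto
        finally have 1: "real n \<le> max 1 (1 / C) * (1 / ?P n)" .
        have "1 * real n \<le> max 1 (1 / C) * real n" by (intro mult_right_mono) auto
        with 1 show ?case by (simp only: min_def) simp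
      qed
    qed simp
  qed
  ultimately show ?thesis using main by blast
qed

end
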